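(* For every integer $n\ge1$, the $\mathrm{SA}'_+$-rank of $MT(K_{2n+1})$ is at most $n-\left\lfloor\frac{\sqrt{2n+1}-1}{2}\right\rfloor$.
   Context: **Notation.** Let $d\ge 1$, $[d]=\{1,\dots,d\}$, $\mathcal F=\{0,1\}^d$. For $P\subseteq[0,1]^d$ let $P_I=\mathrm{conv}(P\cap\{0,1\}^d)$ and $K(P)=\{(\lambda,\lambda x)\in\mathbb R^{d+1}:\lambda\ge 0,\ x\in P\}$. For $S\subseteq[d]$, $t\in\{0,1\}$, let $S|_t=\{x\in\mathcal F: x_i=t\ \forall i\in S\}$ (so $\emptyset|_t=\mathcal F$) and $i|_t=\{i\}|_t$. For $k\ge0$ let $\mathcal A_k=\{S|_1\cap T|_0:S,T\subseteq[d],\ S\cap T=\emptyset,\ |S|+|T|\le k\}$. Matrices have rows and columns indexed by families of subsets of $\mathcal F$; $Ye_\alpha$ is the column of $Y$ indexed by $\alpha$. For a vector $y$ indexed by a family containing $\mathcal F$ and all $i|_1$, $\hat x(y)=(y_{\mathcal F},y_{1|_1},\dots,y_{d|_1})^\top$; for $x\in\mathbb R^d$, $\hat x=(1,x)\in\mathbb R^{d+1}$. **The operator $\mathrm{SA}_+'^k$ ($k\ge1$).** For $P\subseteq[0,1]^d$ let $\tilde{\mathrm{SA}}_+'^k(P)$ be the set of symmetric positive semidefinite matrices $Y$ indexed by $\mathcal A_k\times\mathcal A_k$ such that: (1) $Y[\mathcal F,\mathcal F]=1$; (2) for every $\alpha\in\mathcal A_k$: $\hat x(Ye_\alpha)\in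 K(P)$ and $Ye_\alpha\ge0$; (3) for every $S|_1\cap T|_0\in\mathcal A_{k-1}$ and $j\in[d]\setminus(S\cup T)$: $Ye_{S|_1\cap T|_0\cap j|_1}+Ye_{S|_1\cap T|_0\cap j|_0}=Ye_{S|_1\cap T|_0}$; (4) $Y[\alpha,\beta]=0$ for all $\alpha,\beta\in\mathcal A_k$ with $\alpha\cap\beta=\emptyset$; (4') $Y[\alpha,\beta]=0$ for all $\alpha,\beta\in\mathcal A_k$ with $\mathrm{conv}(\alpha)\cap\mathrm{conv}(\beta)\cap P=\emptyset$; (5) $Y[\alpha_1,\beta_1]=Y[\alpha_2,\beta_2]$ for all $\alpha_1,\alpha_2,\beta_1,\beta_2\in\mathcal A_k$ with $\alpha_1\cap\beta_1=\alpha_2\cap\beta_2$. Then $\mathrm{SA}_+'^k(P)=\{x\in\mathbb R^d:\exists Y\in\tilde{\mathrm{SA}}_+'^k(P),\ \hat x(Ye_{\mathcal F})=\hat x\}$. **Rank.** For an operator $\Gamma$, the $\Gamma$-rank of $P$ is the smallest integer $k\ge 0$ with $\Gamma^k(P)=P_I$, where $\Gamma^0(P)=P$. **Matching relaxation.** For a simple undirected graph $G=(V,E)$, $MT(G)=\{x\in[0,1]^E:\sum_{j:\{i,j\}\in E}x_{ij}\le1\ \forall i\in V\}$; coordinates are indexed by $E$ (so $[d]$ is identified with $E$). $K_m$ is the complete graph on $m$ vertices. *)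

theory Defs
  imports "HOL-Analysis.Analysis" "HOL-Library.Extended_Nat"
begin

text \<open>The coordinate set \<open>[d]\<close> is the finite type \<open>'d\<close>, so that \<open>d = CARD('d) \<ge> 1\<close>.\<close>

definition zero_one :: "(real^'d) set" where
  "zero_one = {x. \<forall>i. x $ i \<in> {0, 1}}"

definition int_hull :: "(real^'d) set \<Rightarrow> (real^'d) set" where
  "int_hull P = convex hull (P \<inter> zero_one)"

definition homog_cone :: "(real^'d) set \<Rightarrow> (real \<times> (real^'d)) set" where
  "homog_cone P = {(l, l *\<^sub>R x) | l x. 0 \<le> l \<and> x \<in> P}"

text \<open>\<open>restr S t\<close> is \<open>S|\<^sub>t\<close>; in particular \<open>restr {} t = zero_one\<close>.\<close>

definition restr :: "'d set \<Rightarrow> real \<Rightarrow> (real^'d) set" where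
  "restr S t = {x \<in> zero_one. \<forall>i\<in>S. x $ i = t}"

definition face_family :: "nat \<Rightarrow> (real^'d) set set" where
  "face_family k =
     {restr S 1 \<inter> restr T 0 | S T. S \<inter> T = {} \<and> card S + card T \<le> k}"

definition hat_vec :: "((real^'d) set \<Rightarrow> real) \<Rightarrow> real \<times> (real^'d)" where
  "hat_vec y = (y zero_one, \<chi> i. y (restr {i} 1))"

definition symmetric_psd_on :: "'a set \<Rightarrow> ('a \<Rightarrow> 'a \<Rightarrow> real) \<Rightarrow> bool" where
  "symmetric_psd_on A Y \<longleftrightarrow>
     (\<forall>a\<in>A. \<forall>b\<in>A. Y a b = Y b a) \<and>
     (\<forall>v. 0 \<le> (\<Sum>a\<in>A. \<Sum>b\<in>A. v a * Y a b * v b))"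

text \<open>
  A matrix indexed by \<open>face_family k\<close> is a function of row and column index that is unconstrained
  outside \<open>face_family k\<close>; its column at \<open>\<alpha>\<close> is \<open>\<lambda>\<beta>. Y \<beta> \<alpha>\<close>. The definition is meant for
  \<open>k \<ge> 1\<close>, so that every index occurring in \<open>hat_vec\<close> lies in \<open>face_family k\<close>.
\<close>

definition SA_plus_lift ::
    "nat \<Rightarrow> (real^'d) set \<Rightarrow> ((real^'d) set \<Rightarrow> (real^'d) set \<Rightarrow> real) set" where
  "SA_plus_lift k P = {Y.
     symmetric_psd_on (face_family k) Y \<and>
     Y zero_one zero_one = 1 \<and>
     (\<forall>\<alpha>\<in>face_family k.
        hat_vec (\<lambda>\<beta>. Y \<beta> \<alpha>) \<in> homog_cone P \<and> (\<forall>\<beta>\<in>face_family k. 0 \<le> Y \<beta> \<alpha>)) \<and>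
     (\<forall>S T j. S \<inter> T = {} \<longrightarrow> card S + card T \<le> k - 1 \<longrightarrow> j \<notin> S \<union> T \<longrightarrow>
        (\<forall>\<beta>\<in>face_family k.
           Y \<beta> (restr S 1 \<inter> restr T 0 \<inter> restr {j} 1) + Y \<beta> (restr S 1 \<inter> restr T 0 \<inter> restr {j} 0)
             = Y \<beta> (restr S 1 \<inter> restr T 0))) \<and>
     (\<forall>\<alpha>\<in>face_family k. \<forall>\<beta>\<in>face_family k. \<alpha> \<inter> \<beta> = {} \<longrightarrow> Y \<alpha> \<beta> = 0) \<and>
     (\<forall>\<alpha>\<in>face_family k. \<forall>\<beta>\<in>face_family k.
        (convex hull \<alpha>) \<inter> (convex hull \<beta>) \<inter> P = {} \<longrightarrow> Y \<alpha> \<beta> = 0) \<and>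
     (\<forall>\<alpha>1\<in>face_family k. \<forall>\<alpha>2\<in>face_family k. \<forall>\<beta>1\<in>face_family k. \<forall>\<beta>2\<in>face_family k.
        \<alpha>1 \<inter> \<beta>1 = \<alpha>2 \<inter> \<beta>2 \<longrightarrow> Y \<alpha>1 \<beta>1 = Y \<alpha>2 \<beta>2)}"

definition SA_plus :: "nat \<Rightarrow> (real^'d) set \<Rightarrow> (real^'d) set" where
  "SA_plus k P = {x. \<exists>Y\<in>SA_plus_lift k P. hat_vec (\<lambda>\<beta>. Y \<beta> zero_one) = (1, x)}"

text \<open>
  The rank is \<open>\<infinity>\<close> if no number of rounds reaches the integer hull; a finite upper bound thus
  includes the claim that the integer hull is reached. The convention \<open>\<Gamma>\<^sup>0(P) = P\<close> is built in.
\<close>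

definition op_rank ::
    "(nat \<Rightarrow> (real^'d) set \<Rightarrow> (real^'d) set) \<Rightarrow> (real^'d) set \<Rightarrow> enat" where
  "op_rank \<Gamma> P = (INF k \<in> {k. (if k = 0 then P else \<Gamma> k P) = int_hull P}. enat k)"

definition complete_edges :: "'v set \<Rightarrow> 'v set set" where
  "complete_edges V = {e. e \<subseteq> V \<and> card e = 2}"

text \<open>
  The edges of a graph on \<open>V\<close> are labelled by the type \<open>'d\<close>: the coordinate \<open>e\<close> stands for the
  edge with set of endpoints \<open>ends e\<close>. The labelling of a simple graph with edge set \<open>E\<close> is a
  bijection \<open>bij_betw ends UNIV E\<close>.
\<close>

definition MT :: "'v set \<Rightarrow> ('d::finite \<Rightarrow> 'v set) \<Rightarrow> (real^'d) set" where
  "MT V ends = {x. (\<forall>e. 0 \<le> x $ e \<and> x $ e \<le> 1) \<and> (\<forall>i\<in>V. (\<Sum>e | i \<in> ends e. x $ e) \<le> 1)}"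

end

theory Submission imports Defs begin

text \<open>
  Let \<open>l = \<lfloor>(sqrt (2n + 1) - 1) / 2\<rfloor>\<close>, so that \<open>2l(l + 1) \<le> n\<close>, and let \<open>k = n - l\<close>. By Edmonds' description
  of the matching polytope (proved by the Cunningham-Marsh induction over integer weights), it
  suffices that every point of \<open>SA_plus k\<close> satisfies the blossom inequality of each odd set \<open>W\<close>;
  say \<open>|W| = 2m + 1\<close>. As \<open>m \<le> 2k\<close>, a lifted matrix contains the moments of a signed measure \<open>p\<close> of
  total mass 1 on the matchings inside \<open>W\<close>, and the claim is that \<open>m - |M|\<close> has nonnegative
  \<open>p\<close>-expectation. Put \<open>K = min k m\<close>.

  If \<open>|M| = m - r \<ge> K\<close>, then \<open>{M}\<close> is the set of matchings that contain \<open>M\<close> and avoid the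
  \<open>r(2r + 1)\<close> edges between uncovered vertices. These are \<open>m + 2r\<^sup>2 \<le> 2K\<close> conditions, so \<open>p M\<close> is an
  entry of the matrix and hence nonnegative. Positive semidefiniteness gives \<open>E f(|M|)\<^sup>2 \<ge> 0\<close> for
  polynomials \<open>f\<close> of degree at most \<open>K\<close>. It remains to find such an \<open>f\<close> with \<open>f(i)\<^sup>2 = m - i\<close> for
  \<open>i < K\<close> and \<open>f(i)\<^sup>2 \<le> m - i\<close> for \<open>K \<le> i \<le> m\<close>; this is \<open>m - i\<close> times the Newton interpolant of
  the absolutely monotone function \<open>1 / sqrt (m - i)\<close> at \<open>0, \<dots>, K - 1\<close>.
\<close>

section \<open>Edmonds' matching polytope theorem\<close>

definition is_matching :: "('d \<Rightarrow> 'v set) \<Rightarrow> 'd set \<Rightarrow> bool" where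
  "is_matching ends M \<longleftrightarrow> (\<forall>e\<in>M. \<forall>e'\<in>M. e \<noteq> e' \<longrightarrow> ends e \<inter> ends e' = {})"

definition covered :: "('d \<Rightarrow> 'v set) \<Rightarrow> 'd set \<Rightarrow> 'v set" where
  "covered ends M = (\<Union>e\<in>M. ends e)"

definition adjacency :: "('d \<Rightarrow> 'v set) \<Rightarrow> 'd set \<Rightarrow> ('v \<times> 'v) set" where
  "adjacency ends F = {(u, v). \<exists>e\<in>F. ends e = {u, v}}"

lemma is_matching_subset: "is_matching ends M \<Longrightarrow> N \<subseteq> M \<Longrightarrow> is_matching ends N"
  unfolding is_matching_def by blast

lemma card_covered:
  assumes "finite M" "is_matching ends M" "\<And>e. card (ends e) = 2"
  shows "card (covered ends M) = 2 * card M"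
proof -
  have "finite (ends e)" for e
    using assms(3)[of e] by (metis card.infinite zero_neq_numeral)
  then have "card (covered ends M) = (\<Sum>e\<in>M. card (ends e))"
    unfolding covered_def using assms
    by (intro card_UN_disjoint) (auto simp: is_matching_def)
  then show ?thesis using assms(3) by simp
qed

text \<open>A connected graph has at most one vertex more than edges. Take a maximal vertex set
  \<open>D\<close> around \<open>t\<close> that satisfies the bound: an edge leaving it could be
  absorbed with its far end, adding one vertex and at least one inner edge, so \<open>D\<close> is
  the whole component.\<close>

lemma card_reachable_le:
  fixes ends :: "'d \<Rightarrow> 'v set"
  assumes "finite F" and fin: "finite ((adjacency ends F)\<^sup>* `` {t})"
  shows "card ((adjacency ends F)\<^sup>* `` {t})
    \<le> Suc (card {e\<in>F. ends e \<subseteq> (adjacency ends F)\<^sup>* `` {t}})"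
proof -
  define R where "R = adjacency ends F"
  define C where "C = R\<^sup>* `` {t}"
  define good where "good D \<longleftrightarrow> t \<in> D \<and> D \<subseteq> C \<and> card D \<le> Suc (card {e\<in>F. ends e \<subseteq> D})" for D
  have finC: "finite C" using fin by (simp add: C_def R_def)
  have "good {t}" by (auto simp: good_def C_def)
  moreover have "finite (Collect good)"
    by (rule finite_subset[of _ "Pow C"]) (auto simp: good_def finC)
  ultimately obtain D where D: "good D" and Dmax: "\<And>D'. good D' \<Longrightarrow> D \<subseteq> D' \<Longrightarrow> D' = D"
    using finite_has_maximal2[of "Collect good" "{t}"] by (metis mem_Collect_eq)
  have "D = C"
  proof (rule ccontr)
    assume "D \<noteq> C"
    have "\<exists>u v. (u, v) \<in> R \<and> u \<in> D \<and> v \<notin> D"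
    proof (rule ccontr)
      assume closed: "\<not> ?thesis"
      have "v \<in> D" if "(t, v) \<in> R\<^sup>*" for v
        using that by induction (use D closed in \<open>auto simp: good_def\<close>)
      then have "C \<subseteq> D" by (auto simp: C_def)
      with D \<open>D \<noteq> C\<close> show False by (auto simp: good_def)
    qed
    then obtain u v where uv: "(u, v) \<in> R" "u \<in> D" "v \<notin> D" by blast
    then obtain e where e: "e \<in> F" "ends e = {u, v}" by (auto simp: R_def adjacency_def)
    have "v \<in> C"
      using uv D by (auto simp: C_def good_def intro: rtrancl.rtrancl_into_rtrancl)
    have "insert e {e\<in>F. ends e \<subseteq> D} \<subseteq> {e\<in>F. ends e \<subseteq> insert v D}"
      using e uv by auto
    then have "card (insert e {e\<in>F. ends e \<subseteq> D}) \<le> card {e\<in>F. ends e \<subseteq> insert v D}"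
      using \<open>finite F\<close> by (intro card_mono) auto
    moreover have "card (insert e {e\<in>F. ends e \<subseteq> D}) = Suc (card {e\<in>F. ends e \<subseteq> D})"
      using \<open>finite F\<close> e uv by (subst card_insert_disjoint) auto
    moreover have "card (insert v D) \<le> Suc (card D)"
      by (simp add: card_insert_le_m1)
    ultimately have "good (insert v D)"
      using D \<open>v \<in> C\<close> by (auto simp: good_def)
    with Dmax uv show False by blast
  qed
  with D show ?thesis by (auto simp: good_def C_def R_def)
qed

text \<open>Exchanging \<open>M\<close> and \<open>N\<close> on the component of \<open>t\<close>, an alternating path, makes the result miss
  \<open>t\<close> and still miss one of \<open>u\<close>, \<open>v\<close>: a path has only two end points.\<close>

lemma matching_exchange:
  fixes ends :: "'d::finite \<Rightarrow> 'v set" and w :: "'d \<Rightarrow> nat"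
  assumes card2: "\<And>e. card (ends e) = 2"
    and M: "is_matching ends M" and N: "is_matching ends N"
    and t: "t \<notin> covered ends N"
    and uv: "u \<noteq> v" "u \<notin> covered ends M" "v \<notin> covered ends M"
  obtains A B where "A \<subseteq> M" "B \<subseteq> N" "is_matching ends (M - A \<union> B)" "is_matching ends (N - B \<union> A)"
    "t \<notin> covered ends (M - A \<union> B)"
    "u \<notin> covered ends (M - A \<union> B) \<or> v \<notin> covered ends (M - A \<union> B)"
    "card B \<le> card A" "(M - A) \<inter> B = {}" "(N - B) \<inter> A = {}"
    "\<And>e. e \<in> A \<union> B \<Longrightarrow> ends e \<subseteq> (adjacency ends (M \<union> N))\<^sup>* `` {t}"
proof -
  define C where "C = (adjacency ends (M \<union> N))\<^sup>* `` {t}"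
  define A where "A = {e\<in>M. ends e \<subseteq> C}"
  define B where "B = {e\<in>N. ends e \<subseteq> C}"
  have fin: "finite (ends e)" for e
    using card2[of e] by (metis card.infinite zero_neq_numeral)
  have closed: "ends e \<subseteq> C" if e: "e \<in> M \<union> N" and z: "z \<in> ends e" "z \<in> C" for e z
  proof -
    obtain p q where pq: "ends e = {p, q}" using card2[of e] by (meson card_2_iff)
    have "(p, q) \<in> adjacency ends (M \<union> N)" "(q, p) \<in> adjacency ends (M \<union> N)"
      using e pq by (auto simp: adjacency_def insert_commute)
    then show ?thesis
      using z pq by (auto simp: C_def intro: rtrancl.rtrancl_into_rtrancl)
  qed
  have tC: "t \<in> C" by (simp add: C_def)
  have finC: "finite C"
  proof (rule finite_subset)
    show "C \<subseteq> insert t (covered ends (M \<union> N))"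
    proof
      fix z assume "z \<in> C"
      then have "(t, z) \<in> (adjacency ends (M \<union> N))\<^sup>*" by (simp add: C_def)
      then show "z \<in> insert t (covered ends (M \<union> N))"
        by cases (auto simp: adjacency_def covered_def)
    qed
  qed (simp add: covered_def fin)
  have cA: "covered ends A = covered ends M \<inter> C" and cB: "covered ends B = covered ends N \<inter> C"
    using closed by (fastforce simp: covered_def A_def B_def)+
  have mA: "is_matching ends A" and mB: "is_matching ends B"
    using M N by (auto intro: is_matching_subset simp: A_def B_def)
  have cardA: "card (covered ends M \<inter> C) = 2 * card A"
    using card_covered[OF _ mA card2] cA by simp
  have cardB: "card (covered ends N \<inter> C) = 2 * card B"
    using card_covered[OF _ mB card2] cB by simp
  have "card C \<le> Suc (card {e \<in> M \<union> N. ends e \<subseteq> C})"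
    unfolding C_def by (rule card_reachable_le) (use finC in \<open>auto simp: C_def\<close>)
  also have "{e \<in> M \<union> N. ends e \<subseteq> C} = A \<union> B" by (auto simp: A_def B_def)
  finally have conn: "card C \<le> Suc (card A + card B)"
    using card_Un_le[of A B] by linarith
  \<comment> \<open>Since \<open>N\<close> misses \<open>t\<close>, the component has at least
    \<open>2 * card B + 1\<close> vertices; against \<open>conn\<close> this forces
    \<open>card B \<le> card A\<close>.\<close>
  have "card (covered ends N \<inter> C) \<le> card (C - {t})"
    using t finC by (intro card_mono) auto
  then have B1: "2 * card B \<le> card C - 1" using cardB tC finC by simp
  have BA: "card B \<le> card A" using conn B1 by linarith
  \<comment> \<open>With both vertices in \<open>C\<close>, also
    \<open>2 * card A + 2 \<le> card C\<close>; adding \<open>2 * card B + 1 \<le> card C\<close>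
    contradicts \<open>conn\<close>.\<close>
  have notboth: "u \<notin> C \<or> v \<notin> C"
  proof (rule ccontr)
    assume "\<not> ?thesis"
    then have uvC: "{u, v} \<subseteq> C" by auto
    have "card (covered ends M \<inter> C) \<le> card (C - {u, v})"
      using uv finC by (intro card_mono) auto
    moreover have "card (C - {u, v}) = card C - 2"
      using uv uvC finC by (subst card_Diff_subset) auto
    moreover have "card C \<ge> 2"
      using uv finC card_mono[OF finC uvC] by simp
    ultimately have "2 * card A \<le> card C - 2" "card C \<ge> 2" using cardA by auto
    then show False using conn B1 by linarith
  qed
  have outM: "ends e \<inter> C = {}" if "e \<in> M - A" for e
    using that closed[of e] by (auto simp: A_def)
  have outN: "ends e \<inter> C = {}" if "e \<in> N - B" for e
    using that closed[of e] by (auto simp: B_def)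
  have inA: "ends e \<subseteq> C" if "e \<in> A" for e using that by (simp add: A_def)
  have inB: "ends e \<subseteq> C" if "e \<in> B" for e using that by (simp add: B_def)
  have ne: "ends e \<noteq> {}" for e using card2[of e] by auto
  show thesis
  proof (rule that[of A B])
    show "is_matching ends (M - A \<union> B)"
      unfolding is_matching_def
    proof (intro ballI impI)
      fix e e' assume "e \<in> M - A \<union> B" "e' \<in> M - A \<union> B" "e \<noteq> e'"
      then show "ends e \<inter> ends e' = {}"
        using M mB outM inB unfolding is_matching_def by blast
    qed
    show "is_matching ends (N - B \<union> A)"
      unfolding is_matching_def
    proof (intro ballI impI)
      fix e e' assume "e \<in> N - B \<union> A" "e' \<in> N - B \<union> A" "e \<noteq> e'"
      then show "ends e \<inter> ends e' = {}"
        using N mA outN inA unfolding is_matching_def by blast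
    qed
    show "t \<notin> covered ends (M - A \<union> B)"
      using outM t tC by (fastforce simp: covered_def B_def)
    show "u \<notin> covered ends (M - A \<union> B) \<or> v \<notin> covered ends (M - A \<union> B)"
      using notboth uv inB by (fastforce simp: covered_def)
    show "(M - A) \<inter> B = {}" using outM inB ne by blast
    show "(N - B) \<inter> A = {}" using outN inA ne by blast
  qed (use BA in \<open>auto simp: A_def B_def C_def\<close>)
qed

section \<open>The Cunningham-Marsh induction for integer weights\<close>

lemma sum_exchange:
  fixes w :: "'d::finite \<Rightarrow> nat"
  assumes "A \<subseteq> M" "(M - A) \<inter> B = {}"
  shows "sum w (M - A \<union> B) + sum w A = sum w M + sum w B"
proof -
  have "sum w (M - A \<union> B) = sum w (M - A) + sum w B"
    using assms by (intro sum.union_disjoint) auto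
  moreover have "sum w M = sum w (M - A) + sum w A"
    using assms by (simp add: sum.subset_diff)
  ultimately show ?thesis by simp
qed

text \<open>Double counting: each edge inside \<open>U\<close> contributes at both ends to the
  degree sums over \<open>U\<close>. This replaces the blossom inequality when \<open>card U\<close>
  is even.\<close>

lemma sum_edges_within_le:
  fixes ends :: "'d::finite \<Rightarrow> 'v set" and x :: "'d \<Rightarrow> real"
  assumes card2: "\<And>e. card (ends e) = 2" and "finite U"
    and "\<And>e. 0 \<le> x e" "\<And>v. v \<in> U \<Longrightarrow> (\<Sum>e | v \<in> ends e. x e) \<le> 1"
  shows "2 * (\<Sum>e | ends e \<subseteq> U. x e) \<le> card U"
proof -
  have "2 * (\<Sum>e | ends e \<subseteq> U. x e) = (\<Sum>e | ends e \<subseteq> U. \<Sum>v\<in>ends e. x e)"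
    by (simp add: card2 sum_distrib_left)
  also have "\<dots> = (\<Sum>e | ends e \<subseteq> U. \<Sum>v\<in>U. if v \<in> ends e then x e else 0)"
  proof (rule sum.cong)
    fix e assume "e \<in> {e. ends e \<subseteq> U}"
    then have "U \<inter> ends e = ends e" by auto
    then show "(\<Sum>v\<in>ends e. x e) = (\<Sum>v\<in>U. if v \<in> ends e then x e else 0)"
      using \<open>finite U\<close> by (simp add: sum.inter_restrict[symmetric])
  qed simp
  also have "\<dots> = (\<Sum>v\<in>U. \<Sum>e | ends e \<subseteq> U. if v \<in> ends e then x e else 0)"
    by (rule sum.swap)
  also have "\<dots> \<le> (\<Sum>v\<in>U. \<Sum>e | v \<in> ends e. x e)"
  proof (rule sum_mono)
    fix v
    have "(\<Sum>e | ends e \<subseteq> U. if v \<in> ends e then x e else 0) \<le> (\<Sum>e\<in>UNIV. if v \<in> ends e then x e else 0)"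
      by (rule sum_mono2) (use assms(3) in auto)
    then show "(\<Sum>e | ends e \<subseteq> U. if v \<in> ends e then x e else 0) \<le> (\<Sum>e | v \<in> ends e. x e)"
      by (simp add: sum.If_cases)
  qed
  also have "\<dots> \<le> (\<Sum>v\<in>U. 1)" by (rule sum_mono) (use assms(4) in auto)
  finally show ?thesis by simp
qed

text \<open>Induction on the total weight. If some vertex lies in every maximum-weight matching,
  lower the weights at it by one and pay with its degree constraint. Otherwise lower the weights
  inside a component of the support and pay with its blossom inequality: some matching that is
  optimal for the lowered weights misses at most one vertex there.\<close>

lemma ex_matching_ge_nat_weight:
  fixes ends :: "'d::finite \<Rightarrow> 'v set" and x :: "'d \<Rightarrow> real" and w :: "'d \<Rightarrow> nat"
  assumes card2: "\<And>e. card (ends e) = 2" and V: "\<And>e. ends e \<subseteq> V" "finite V"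
    and x0: "\<And>e. 0 \<le> x e" and deg: "\<And>v. v \<in> V \<Longrightarrow> (\<Sum>e | v \<in> ends e. x e) \<le> 1"
    and blossom: "\<And>U. U \<subseteq> V \<Longrightarrow> odd (card U) \<Longrightarrow> 2 * (\<Sum>e | ends e \<subseteq> U. x e) \<le> real (card U) - 1"
  shows "\<exists>M. is_matching ends M \<and> (\<Sum>e\<in>UNIV. real (w e) * x e) \<le> real (sum w M)"
proof (induction "sum w UNIV" arbitrary: w rule: less_induct)
  case less
  show ?case
  proof (cases "\<forall>e. w e = 0")
    case True
    then show ?thesis by (intro exI[of _ "{}"]) (simp add: is_matching_def)
  next
    case False
    then obtain e0 where e0: "w e0 > 0" by auto
    have dec: "real i * x e \<le> real (i - 1) * x e + x e" for i e
      using mult_right_mono[of "real i" "real (i - 1) + 1" "x e"] x0[of e]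
      by (simp add: algebra_simps)
    \<comment> \<open>Only edges of positive weight enter, so that lowering by one is exact on the
      members of \<open>\<N>\<close>.\<close>
    define supp where "supp = {e. w e > 0}"
    define \<N> where "\<N> = {M. is_matching ends M \<and> M \<subseteq> supp}"
    have \<N>0: "{} \<in> \<N>" by (simp add: \<N>_def is_matching_def)
    define Opt where "Opt = {N\<in>\<N>. \<forall>M\<in>\<N>. sum w M \<le> sum w N}"
    have "\<exists>N\<in>\<N>. \<forall>M\<in>\<N>. f M \<le> f N" for f :: "'d set \<Rightarrow> nat"
    proof -
      have "Max (f ` \<N>) \<in> f ` \<N>" using \<N>0 by (intro Max_in) auto
      then obtain N where "N \<in> \<N>" "f N = Max (f ` \<N>)" by auto
      then show ?thesis by (metis Max_ge finite finite_imageI imageI)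
    qed note ex_max = this
    obtain N0 where N0: "N0 \<in> Opt" using ex_max[of "sum w"] by (auto simp: Opt_def)
    show ?thesis
    proof (cases "\<exists>v. \<forall>N\<in>Opt. v \<in> covered ends N")
      case True
      then obtain v where v: "\<And>N. N \<in> Opt \<Longrightarrow> v \<in> covered ends N" by blast
      define w' where "w' e = (if v \<in> ends e then w e - 1 else w e)" for e
      obtain e1 where e1: "e1 \<in> N0" "v \<in> ends e1" using v[OF N0] by (auto simp: covered_def)
      then have "w e1 > 0" using N0 by (auto simp: Opt_def \<N>_def supp_def)
      have "sum w' UNIV < sum w UNIV"
        by (rule sum_strict_mono_ex1) (use e1 \<open>w e1 > 0\<close> in \<open>auto simp: w'_def intro!: exI[of _ e1]\<close>)
      then obtain M1 where M1: "is_matching ends M1" "(\<Sum>e\<in>UNIV. real (w' e) * x e) \<le> real (sum w' M1)"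
        using less by blast
      define M where "M = M1 \<inter> supp"
      have MN: "M \<in> \<N>" using M1 by (auto simp: \<N>_def M_def intro: is_matching_subset)
      have "sum w' M1 = sum w' M"
        unfolding M_def by (rule sum.mono_neutral_right) (auto simp: supp_def w'_def)
      \<comment> \<open>The lowered weight of \<open>M\<close> is at least one unit below the
        optimum: an optimal \<open>M\<close> covers \<open>v\<close> and loses that unit, and any
        other \<open>M\<close> was below the optimum already.\<close>
      have lt: "sum w' M < sum w N0"
      proof (cases "M \<in> Opt")
        case True
        then obtain e where e: "e \<in> M" "v \<in> ends e" using v by (auto simp: covered_def)
        have "sum w' M < sum w M"
          by (rule sum_strict_mono_ex1) (use e in \<open>auto simp: w'_def M_def supp_def intro!: bexI[of _ e]\<close>)
        then show ?thesis using N0 MN by (auto simp: Opt_def intro: less_le_trans)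
      next
        case False
        then obtain M' where "M' \<in> \<N>" "sum w M < sum w M'"
          using MN by (auto simp: Opt_def not_le)
        moreover have "sum w' M \<le> sum w M" by (rule sum_mono) (simp add: w'_def)
        ultimately show ?thesis using N0 by (fastforce simp: Opt_def)
      qed
      have "v \<in> V" using e1 V by auto
      have "(\<Sum>e\<in>UNIV. real (w e) * x e) \<le> (\<Sum>e\<in>UNIV. real (w' e) * x e + (if v \<in> ends e then x e else 0))"
        by (rule sum_mono) (use dec in \<open>auto simp: w'_def\<close>)
      also have "\<dots> = (\<Sum>e\<in>UNIV. real (w' e) * x e) + (\<Sum>e | v \<in> ends e. x e)"
        by (simp add: sum.distrib sum.If_cases)
      also have "\<dots> \<le> real (sum w' M) + 1"
        using M1 deg[OF \<open>v \<in> V\<close>] \<open>sum w' M1 = sum w' M\<close> by simp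
      also have "\<dots> \<le> real (sum w N0)" using lt by linarith
      finally show ?thesis using N0 by (auto simp: Opt_def \<N>_def)
    next
      case False
      then have miss: "\<exists>N\<in>Opt. v \<notin> covered ends N" for v by blast
      define R where "R = adjacency ends supp"
      obtain a b where ab: "ends e0 = {a, b}" using card2[of e0] by (meson card_2_iff)
      \<comment> \<open>A component of the support containing the ends of \<open>e0\<close>, so
        lowering the weights inside it strictly decreases the total weight.\<close>
      define U where "U = R\<^sup>* `` {a}"
      have aU: "a \<in> U" by (simp add: U_def)
      have symR: "(p, q) \<in> R \<Longrightarrow> (q, p) \<in> R" for p q
        by (auto simp: R_def adjacency_def insert_commute)
      have Uclosed: "ends e \<subseteq> U" if "e \<in> supp" "z \<in> ends e" "z \<in> U" for e z
      proof -
        obtain p q where pq: "ends e = {p, q}" using card2[of e] by (meson card_2_iff)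
        then have "(p, q) \<in> R" using that by (auto simp: R_def adjacency_def)
        then show ?thesis
          using pq that symR[of p q] by (auto simp: U_def intro: rtrancl.rtrancl_into_rtrancl)
      qed
      have UV: "U \<subseteq> V"
      proof
        fix z assume "z \<in> U"
        then have "(a, z) \<in> R\<^sup>*" by (simp add: U_def)
        then show "z \<in> V"
          by cases (use ab V(1)[of e0] V(1) in \<open>auto simp: R_def adjacency_def\<close>)
      qed
      then have finU: "finite U" using V finite_subset by blast
      define w' where "w' e = (if ends e \<subseteq> U then w e - 1 else w e)" for e
      have e0U: "ends e0 \<subseteq> U" using Uclosed[of e0 a] e0 ab aU by (auto simp: supp_def)
      have "sum w' UNIV < sum w UNIV"
        by (rule sum_strict_mono_ex1) (use e0 e0U in \<open>auto simp: w'_def intro!: exI[of _ e0]\<close>)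
      then obtain M1 where M1: "is_matching ends M1" "(\<Sum>e\<in>UNIV. real (w' e) * x e) \<le> real (sum w' M1)"
        using less by blast
      have M1N: "M1 \<inter> supp \<in> \<N>" using M1 by (auto simp: \<N>_def intro: is_matching_subset)
      have M1w: "sum w' M1 = sum w' (M1 \<inter> supp)"
        by (rule sum.mono_neutral_right) (auto simp: supp_def w'_def)
      \<comment> \<open>maximizing \<open>\<phi>\<close> maximizes the weight \<open>w'\<close> first and the cardinality second\<close>
      define \<phi> where "\<phi> M = sum w' M * Suc (card (UNIV :: 'd set)) + card M" for M
      define Best where "Best = {M\<in>\<N>. \<forall>N\<in>\<N>. \<phi> N \<le> \<phi> M}"
      have \<phi>_less: "\<phi> M < \<phi> N" if "sum w' M < sum w' N" for M N
      proof -
        have "card M \<le> card (UNIV :: 'd set)" by (simp add: card_mono)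
        moreover have "Suc (sum w' M) * Suc (card (UNIV :: 'd set)) \<le> sum w' N * Suc (card (UNIV :: 'd set))"
          using that by (intro mult_right_mono) auto
        ultimately show ?thesis by (simp add: \<phi>_def)
      qed
      have w_eq: "sum w M = sum w' M + card {e\<in>M. ends e \<subseteq> U}" if "M \<subseteq> supp" for M
      proof -
        have "sum w M = (\<Sum>e\<in>M. w' e + (if ends e \<subseteq> U then 1 else 0))"
          by (rule sum.cong) (use that in \<open>auto simp: w'_def supp_def\<close>)
        also have "\<dots> = sum w' M + card (M \<inter> {e. ends e \<subseteq> U})"
          by (simp add: sum.distrib sum.If_cases)
        also have "M \<inter> {e. ends e \<subseteq> U} = {e\<in>M. ends e \<subseteq> U}" by auto
        finally show ?thesis .
      qed
      \<comment> \<open>\<open>linked\<close> is transitive on the support component \<open>U\<close>, as in Gallai's lemma, so a best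
        matching misses at most one vertex of \<open>U\<close>.\<close>
      define linked where "linked p q \<longleftrightarrow> (\<forall>M\<in>Best. p \<in> covered ends M \<or> q \<in> covered ends M)" for p q
      \<comment> \<open>The edge may have lowered weight 0, so adding it need not raise
        \<open>w'\<close>; it does raise the cardinality, which is why \<open>\<phi>\<close> counts
        edges.\<close>
      have linked_edge: "linked p q" if pq: "(p, q) \<in> R" for p q
        unfolding linked_def
      proof (rule ballI, rule ccontr)
        fix M assume M: "M \<in> Best" and nc: "\<not> (p \<in> covered ends M \<or> q \<in> covered ends M)"
        obtain e where e: "e \<in> supp" "ends e = {p, q}" using pq by (auto simp: R_def adjacency_def)
        have "insert e M \<in> \<N>"
          using M e nc by (auto simp: Best_def \<N>_def is_matching_def covered_def)
        moreover have "e \<notin> M" using e nc by (auto simp: covered_def)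
        then have "\<phi> M < \<phi> (insert e M)" by (simp add: \<phi>_def add_mult_distrib)
        ultimately show False using M by (auto simp: Best_def)
      qed
      have linked_trans: "linked p q" if t: "t \<in> U" and pt: "linked p t" and tq: "linked t q" and "p \<noteq> q" for p t q
        unfolding linked_def
      proof (rule ballI, rule ccontr)
        fix M assume M: "M \<in> Best" and nc: "\<not> (p \<in> covered ends M \<or> q \<in> covered ends M)"
        have MN: "M \<in> \<N>" using M by (simp add: Best_def)
        obtain N where N: "N \<in> Opt" "t \<notin> covered ends N" using miss by blast
        have NN: "N \<in> \<N>" using N by (simp add: Opt_def)
        obtain A B where AB: "A \<subseteq> M" "B \<subseteq> N" "is_matching ends (M - A \<union> B)" "is_matching ends (N - B \<union> A)"
          "t \<notin> covered ends (M - A \<union> B)"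
          "p \<notin> covered ends (M - A \<union> B) \<or> q \<notin> covered ends (M - A \<union> B)"
          "card B \<le> card A" "(M - A) \<inter> B = {}" "(N - B) \<inter> A = {}"
          and sub: "\<And>e. e \<in> A \<union> B \<Longrightarrow> ends e \<subseteq> (adjacency ends (M \<union> N))\<^sup>* `` {t}"
          by (rule matching_exchange[of ends M N t p q, OF card2])
            (use MN NN N nc \<open>p \<noteq> q\<close> in \<open>auto simp: \<N>_def\<close>)
        have "adjacency ends (M \<union> N) \<subseteq> R"
          using MN NN by (auto simp: R_def adjacency_def \<N>_def)
        then have "(adjacency ends (M \<union> N))\<^sup>* \<subseteq> R\<^sup>*" by (rule rtrancl_mono)
        then have "(adjacency ends (M \<union> N))\<^sup>* `` {t} \<subseteq> U"
          using t by (auto simp: U_def intro: rtrancl_trans)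
        then have inU: "ends e \<subseteq> U" if "e \<in> A \<union> B" for e using sub that by blast
        let ?M = "M - A \<union> B" and ?N = "N - B \<union> A"
        have M'N: "?M \<in> \<N>" and N'N: "?N \<in> \<N>" using AB MN NN by (auto simp: \<N>_def)
        \<comment> \<open>Optimality of \<open>N\<close> gives \<open>sum w A \<le> sum w B\<close>,
          that of \<open>M\<close> gives \<open>sum w' B \<le> sum w' A\<close>. Inside
          \<open>U\<close> the two weights differ by the number of edges, and
          \<open>card B \<le> card A\<close>, so equality holds throughout. The exchanged
          \<open>M\<close> is again best, yet misses \<open>t\<close> and one of \<open>p\<close>,
          \<open>q\<close>.\<close>
        have "sum w ?N \<le> sum w N" using N N'N by (simp add: Opt_def)
        then have wAB: "sum w A \<le> sum w B" using sum_exchange[of B N A w] AB by simp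
        have "{e\<in>A. ends e \<subseteq> U} = A" "{e\<in>B. ends e \<subseteq> U} = B" using inU by auto
        then have wA: "sum w A = sum w' A + card A" and wB: "sum w B = sum w' B + card B"
          using w_eq[of A] w_eq[of B] AB MN NN by (auto simp: \<N>_def)
        have "sum w' ?M \<le> sum w' M"
          using \<phi>_less[of M ?M] M M'N by (auto simp: Best_def not_le[symmetric])
        then have "sum w' B \<le> sum w' A" using sum_exchange[of A M B w'] AB by simp
        then have eqs: "sum w' B = sum w' A" "card B = card A" using wA wB wAB AB by linarith+
        have "sum w' ?M = sum w' M" using sum_exchange[of A M B w'] AB eqs by simp
        moreover have "card ?M = card M"
          using sum_exchange[of A M B "\<lambda>_. 1"] AB eqs by simp
        ultimately have "\<phi> ?M = \<phi> M" by (simp add: \<phi>_def)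
        then have "?M \<in> Best" using M M'N by (simp add: Best_def)
        then show False using pt tq AB(5,6) by (auto simp: linked_def)
      qed
      have linked_sym: "linked p q \<Longrightarrow> linked q p" for p q by (auto simp: linked_def)
      have linked_a: "z = a \<or> linked a z" if "z \<in> U" for z
      proof -
        have "(a, z) \<in> R\<^sup>*" using that by (simp add: U_def)
        then show ?thesis
        proof induction
          case (step y z)
          then show ?case
            using linked_edge[of y z] linked_trans[of y a z] by (auto simp: U_def)
        qed simp
      qed
      obtain M where M: "M \<in> Best" using ex_max[of \<phi>] by (auto simp: Best_def)
      have MN: "M \<in> \<N>" using M by (simp add: Best_def)
      have "p = q" if "p \<in> U - covered ends M" "q \<in> U - covered ends M" for p q
      proof (rule ccontr)
        assume "p \<noteq> q"
        then have "linked p q"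
          using that linked_a[of p] linked_a[of q] linked_sym linked_trans[OF aU, of p q] by auto
        then show False using that M by (auto simp: linked_def)
      qed
      then have "card (U - covered ends M) \<le> 1"
        using finU by (auto simp: card_le_Suc0_iff_eq)
      define MU where "MU = {e\<in>M. ends e \<subseteq> U}"
      have "covered ends MU = U \<inter> covered ends M"
        using Uclosed MN by (fastforce simp: covered_def MU_def \<N>_def)
      moreover have "is_matching ends MU" using MN by (auto simp: MU_def \<N>_def intro: is_matching_subset)
      ultimately have "card (U \<inter> covered ends M) = 2 * card MU"
        using card_covered[of MU ends] card2 by simp
      moreover have "card U = card (U \<inter> covered ends M) + card (U - covered ends M)"
        using finU by (metis card_Int_Diff)
      ultimately have cU: "card U \<le> 2 * card MU + 1"
        using \<open>card (U - covered ends M) \<le> 1\<close> by linarith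
      \<comment> \<open>\<open>card MU\<close> is at least half of \<open>card U\<close>, rounded
        down: the bound of the blossom inequality for odd \<open>U\<close> and of the degree
        constraints for even \<open>U\<close>.\<close>
      have xU: "(\<Sum>e | ends e \<subseteq> U. x e) \<le> real (card MU)"
      proof (cases "odd (card U)")
        case True
        then show ?thesis using blossom[OF UV] cU by linarith
      next
        case False
        then have "card U \<le> 2 * card MU" using cU by presburger
        moreover have "2 * (\<Sum>e | ends e \<subseteq> U. x e) \<le> card U"
          by (rule sum_edges_within_le) (use card2 finU x0 deg UV in auto)
        ultimately show ?thesis by linarith
      qed
      \<comment> \<open>In going back from \<open>w'\<close> to \<open>w\<close>, the left side
        grows by at most the \<open>x\<close>-mass inside \<open>U\<close>, while \<open>M\<close>
        gains exactly \<open>card MU\<close>.\<close>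
      have "sum w' (M1 \<inter> supp) \<le> sum w' M"
        using \<phi>_less[of M "M1 \<inter> supp"] M M1N by (auto simp: Best_def not_le[symmetric])
      moreover have "(\<Sum>e\<in>UNIV. real (w e) * x e) \<le> (\<Sum>e\<in>UNIV. real (w' e) * x e + (if ends e \<subseteq> U then x e else 0))"
        by (rule sum_mono) (use dec in \<open>auto simp: w'_def\<close>)
      moreover have "\<dots> = (\<Sum>e\<in>UNIV. real (w' e) * x e) + (\<Sum>e | ends e \<subseteq> U. x e)"
        by (simp add: sum.distrib sum.If_cases)
      moreover have "sum w M = sum w' M + card MU"
        unfolding MU_def by (rule w_eq) (use MN in \<open>simp add: \<N>_def\<close>)
      ultimately have "(\<Sum>e\<in>UNIV. real (w e) * x e) \<le> real (sum w M)"
        using M1 M1w xU by linarith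
      then show ?thesis using MN by (auto simp: \<N>_def)
    qed
  qed
qed

section \<open>From integer weights to the hull, by separation and rounding\<close>

lemma finite_zero_one: "finite (zero_one :: (real^'d::finite) set)"
proof -
  have "zero_one \<subseteq> (\<lambda>S. \<chi> i. if i \<in> S then 1 else 0) ` (UNIV :: 'd set set)"
  proof
    fix z :: "real^'d" assume "z \<in> zero_one"
    then have "z = (\<chi> i. if i \<in> {i. z $ i = 1} then 1 else 0)"
      by (auto simp: zero_one_def vec_eq_iff)
    then show "z \<in> (\<lambda>S. \<chi> i. if i \<in> S then 1 else 0) ` (UNIV :: 'd set set)" by blast
  qed
  then show ?thesis by (rule finite_subset) simp
qed

lemma matching_indicator_in_MT:
  assumes "is_matching ends M"
  shows "(\<chi> e. if e \<in> M then 1 else 0) \<in> MT V ends \<inter> zero_one"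
proof -
  have "(\<Sum>e | i \<in> ends e. if e \<in> M then 1 else (0::real)) \<le> 1" for i
  proof -
    have "card {e. i \<in> ends e \<and> e \<in> M} \<le> 1"
      using assms by (auto simp: card_le_Suc0_iff_eq is_matching_def)
    then show ?thesis by (simp add: sum.If_cases Int_def)
  qed
  then show ?thesis by (auto simp: MT_def zero_one_def)
qed

text \<open>A hyperplane separating \<open>x\<close> from the hull yields real weights under which
  \<open>x\<close> beats every matching by more than a fixed \<open>\<delta>\<close>. Scaled up and
  rounded down, they contradict the bound for integer weights.\<close>

lemma in_int_hull_MT:
  fixes ends :: "'d::finite \<Rightarrow> 'v set" and x :: "real^'d"
  assumes card2: "\<And>e. card (ends e) = 2" and V: "\<And>e. ends e \<subseteq> V" "finite V"
    and x: "x \<in> MT V ends"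
    and blossom: "\<And>U. U \<subseteq> V \<Longrightarrow> odd (card U) \<Longrightarrow> 2 * (\<Sum>e | ends e \<subseteq> U. x $ e) \<le> real (card U) - 1"
  shows "x \<in> int_hull (MT V ends)"
proof (rule ccontr)
  assume "x \<notin> int_hull (MT V ends)"
  moreover have "finite (MT V ends \<inter> zero_one)" by (simp add: finite_zero_one)
  then have "closed (int_hull (MT V ends))"
    unfolding int_hull_def by (intro compact_imp_closed finite_imp_compact_convex_hull)
  moreover have "convex (int_hull (MT V ends))" by (simp add: int_hull_def)
  ultimately obtain a b where ab: "a \<bullet> x < b" "\<And>z. z \<in> int_hull (MT V ends) \<Longrightarrow> b < a \<bullet> z"
    using separating_hyperplane_closed_point by metis
  define w where "w e = - (a $ e)" for e
  define \<delta> where "\<delta> = b - a \<bullet> x"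
  have \<delta>: "\<delta> > 0" using ab by (simp add: \<delta>_def)
  have x01: "0 \<le> x $ e" "x $ e \<le> 1" for e using x by (auto simp: MT_def)
  have wM: "sum w M < - b" if "is_matching ends M" for M
  proof -
    have "(\<chi> e. if e \<in> M then 1 else 0) \<in> int_hull (MT V ends)"
      unfolding int_hull_def using matching_indicator_in_MT[OF that, of V] hull_subset by fastforce
    from ab(2)[OF this] have "b < (\<Sum>e\<in>UNIV. a $ e * (if e \<in> M then 1 else 0))"
      by (simp add: inner_vec_def)
    also have "\<dots> = - sum w M" by (simp add: w_def sum_negf sum.If_cases if_distrib cong: if_cong)
    finally show ?thesis by simp
  qed
  \<comment> \<open>Rounding costs at most 1 per coordinate; this scaling makes the gap
    \<open>N * \<delta>\<close> exceed the total cost.\<close>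
  obtain N :: nat where N: "real CARD('d) / \<delta> < real N" using reals_Archimedean2 by blast
  define u where "u e = nat \<lfloor>real N * w e\<rfloor>" for e
  obtain M where M: "is_matching ends M" "(\<Sum>e\<in>UNIV. real (u e) * x $ e) \<le> real (sum u M)"
    using ex_matching_ge_nat_weight[where ends = ends and x = "\<lambda>e. x $ e" and w = u, OF card2 V] x01 x blossom
    by (auto simp: MT_def)
  \<comment> \<open>\<open>nat\<close> clips negative values to 0, so the dropped edges contribute
    nothing to \<open>u\<close>, and \<open>u e \<le> N * w e\<close> holds on the remaining
    ones.\<close>
  define M' where "M' = {e\<in>M. w e > 0}"
  have M': "is_matching ends M'" using M by (auto simp: M'_def intro: is_matching_subset)
  have u0: "u e = 0" if "w e \<le> 0" for e
  proof -
    have "real N * w e \<le> 0" using that by (simp add: mult_nonneg_nonpos)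
    then show ?thesis unfolding u_def by linarith
  qed
  have "real (sum u M) = (\<Sum>e\<in>M'. real (u e))"
    unfolding of_nat_sum M'_def
    by (rule sum.mono_neutral_right) (use u0 in \<open>auto simp: not_less\<close>)
  also have "\<dots> \<le> (\<Sum>e\<in>M'. real N * w e)"
    by (rule sum_mono) (auto simp: u_def M'_def)
  also have "\<dots> \<le> real N * (- b)"
    using mult_left_mono[of "sum w M'" "- b" "real N"] wM[OF M']
    by (simp add: sum_distrib_left[symmetric])
  finally have up: "real (sum u M) \<le> real N * (- b)" .
  have "real N * w e * x $ e - 1 \<le> real (u e) * x $ e" for e
  proof -
    have "real N * w e - 1 \<le> real (u e)" unfolding u_def by linarith
    then have "(real N * w e - 1) * x $ e \<le> real (u e) * x $ e"
      using x01 by (intro mult_right_mono) auto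
    then show ?thesis using x01(2)[of e] by (simp add: algebra_simps)
  qed
  then have "(\<Sum>e\<in>UNIV. real N * w e * x $ e - 1) \<le> (\<Sum>e\<in>UNIV. real (u e) * x $ e)"
    by (intro sum_mono)
  moreover have "(\<Sum>e\<in>UNIV. real N * w e * x $ e - 1) = - real N * (a \<bullet> x) - real CARD('d)"
    by (simp add: sum_subtractf inner_vec_def w_def sum_distrib_left sum_negf mult.assoc)
  ultimately have "- real N * (a \<bullet> x) - real CARD('d) \<le> real N * (- b)"
    using M up by linarith
  then have "real N * \<delta> \<le> real CARD('d)" by (simp add: \<delta>_def algebra_simps)
  then show False using N \<delta> by (simp add: field_simps)
qed

section \<open>A square below a linear function\<close>

text \<open>\<open>(-1) ^ r\<close> times the \<open>r\<close>-th forward difference of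
  \<open>x powr (- a)\<close> with step 1; the sign makes it nonnegative for positive
  \<open>a\<close> and \<open>x\<close>.\<close>

primrec powr_diff :: "real \<Rightarrow> nat \<Rightarrow> real \<Rightarrow> real" where
  "powr_diff a 0 x = x powr (- a)"
| "powr_diff a (Suc r) x = powr_diff a r x - powr_diff a r (x + 1)"

lemma powr_diff_has_derivative:
  "x > 0 \<Longrightarrow> (powr_diff a r has_real_derivative - a * powr_diff (a + 1) r x) (at x)"
proof (induction r arbitrary: x)
  case 0
  have "powr_diff a 0 = (\<lambda>x. x powr (- a))" by (simp add: fun_eq_iff)
  then show ?case
    using 0 has_real_derivative_powr[of x "- a"] by (simp add: minus_diff_commute)
next
  case (Suc r)
  have eq: "powr_diff a (Suc r) = (\<lambda>x. powr_diff a r x - powr_diff a r (x + 1))"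
    by (simp add: fun_eq_iff)
  have shift: "((\<lambda>x. powr_diff a r (x + 1)) has_real_derivative - a * powr_diff (a + 1) r (x + 1)) (at x)"
    using Suc.IH[of "x + 1"] Suc.prems by (simp add: DERIV_shift)
  show ?case
    unfolding eq using DERIV_diff[OF Suc.IH[OF Suc.prems] shift] by (simp add: algebra_simps)
qed

text \<open>Induction on \<open>r\<close> for all exponents at once: the derivative is
  \<open>- a\<close> times the same difference for \<open>a + 1\<close>, so the \<open>r\<close>-th
  difference is nonincreasing and the next one nonnegative.\<close>

lemma powr_diff_nonneg: "a > 0 \<Longrightarrow> x > 0 \<Longrightarrow> powr_diff a r x \<ge> 0"
proof (induction r arbitrary: a x)
  case (Suc r)
  have "\<exists>y. (powr_diff a r has_real_derivative y) (at z) \<and> y \<le> 0" if "x \<le> z" for z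
    using powr_diff_has_derivative[of z a r] Suc.IH[of "a + 1" z] Suc.prems that
    by (intro exI[of _ "- a * powr_diff (a + 1) r z"]) auto
  then have "powr_diff a r (x + 1) \<le> powr_diff a r x"
    by (intro DERIV_nonpos_imp_nonincreasing[of x "x + 1"]) auto
  then show ?case by simp
qed simp

text \<open>Newton's forward difference formula for \<open>i \<mapsto> powr_diff a r (y - i)\<close>, read with \<open>y + i\<close>
  for \<open>y\<close>.\<close>

lemma powr_diff_newton:
  "powr_diff a r y = (\<Sum>s\<le>i. real (i choose s) * powr_diff a (r + s) (y + real i - real s))"
proof (induction i arbitrary: r y)
  case (Suc i)
  let ?t = "\<lambda>s. powr_diff a (r + s) (y + real (Suc i) - real s)"
  have "powr_diff a r y = powr_diff a r (y + 1) + powr_diff a (Suc r) y" by simp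
  also have "\<dots> = (\<Sum>s\<le>i. real (i choose s) * ?t s) + (\<Sum>s\<le>i. real (i choose s) * ?t (Suc s))"
    by (subst Suc.IH, subst Suc.IH[of "Suc r"]) (simp add: algebra_simps)
  also have "(\<Sum>s\<le>i. real (i choose s) * ?t s) = (\<Sum>s\<le>Suc i. real (i choose s) * ?t s)"
    by simp
  also have "\<dots> = ?t 0 + (\<Sum>s\<le>i. real (i choose Suc s) * ?t (Suc s))"
    by (subst sum.atMost_Suc_shift) simp
  also have "\<dots> + (\<Sum>s\<le>i. real (i choose s) * ?t (Suc s))
      = ?t 0 + (\<Sum>s\<le>i. real (Suc i choose Suc s) * ?t (Suc s))"
    by (simp add: sum.distrib[symmetric] algebra_simps)
  also have "\<dots> = (\<Sum>s\<le>Suc i. real (Suc i choose s) * ?t s)"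
    by (simp only: sum.atMost_Suc_shift[of _ i]) simp
  finally show ?case .
qed simp

text \<open>The polynomial is \<open>(m - i)\<close> times the Newton interpolant of \<open>1 / sqrt (m - i)\<close> at \<open>0, \<dots>, K - 1\<close>.
  All Newton coefficients are nonnegative, so the interpolant stays below the function.\<close>

lemma ex_square_below_linear:
  assumes "K \<le> m"
  obtains c :: "nat \<Rightarrow> real"
  where "\<And>i. i \<le> m \<Longrightarrow> (\<Sum>s\<le>K. real (i choose s) * c s)\<^sup>2 \<le> real m - real i"
    and "\<And>i. i < K \<Longrightarrow> (\<Sum>s\<le>K. real (i choose s) * c s)\<^sup>2 = real m - real i"
proof -
  \<comment> \<open>The Newton coefficient: the \<open>s\<close>-th forward difference at
    \<open>i = 0\<close> of \<open>1 / sqrt (m - i)\<close>.\<close>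
  define a where "a s = powr_diff (1/2) s (real m - real s)" for s
  define g where "g i = (\<Sum>s<K. real (i choose s) * a s)" for i
  \<comment> \<open>The binomial-basis coefficients of \<open>(m - i) * g i\<close>, from \<open>(m
    - i) * (i choose s) = (m - s) * (i choose s) - (s + 1) * (i choose Suc s)\<close>. At
    \<open>s = 0\<close> the factor \<open>real s\<close> removes the truncated index
    \<open>s - 1\<close>.\<close>
  define c where "c s = (if s < K then (real m - real s) * a s else 0) - real s * a (s - 1)" for s
  have a0: "a s \<ge> 0" if "s < m" for s using that by (simp add: a_def powr_diff_nonneg)
  have newton: "1 / sqrt (real m - real i) = (\<Sum>s\<le>i. real (i choose s) * a s)" if "i < m" for i
    using that powr_diff_newton[of "1/2" 0 "real m - real i" i]
    by (simp add: a_def powr_minus_divide powr_half_sqrt)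
  have fg: "(\<Sum>s\<le>K. real (i choose s) * c s) = (real m - real i) * g i" if "i \<le> m" for i
  proof -
    have absorb: "real (i choose s) * (real i - real s) = real (i choose Suc s) * real (Suc s)" for s
    proof (cases "s \<le> i")
      case True
      have "(i - s) * (i choose s) = (i choose Suc s) * Suc s"
        using binomial_absorb_comp[of i s] binomial_absorption[of s i]
        by (cases i) (simp_all add: algebra_simps)
      then have "real (i - s) * real (i choose s) = real (i choose Suc s) * real (Suc s)"
        by (metis of_nat_mult)
      then show ?thesis using True by (simp add: of_nat_diff mult.commute)
    qed (simp add: binomial_eq_0)
    have "(\<Sum>s\<le>K. real (i choose s) * c s)
        = (\<Sum>s\<le>K. real (i choose s) * (if s < K then (real m - real s) * a s else 0))
          - (\<Sum>s\<le>K. real (i choose s) * (real s * a (s - 1)))"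
      by (simp add: c_def algebra_simps sum_subtractf)
    also have "(\<Sum>s\<le>K. real (i choose s) * (if s < K then (real m - real s) * a s else 0))
        = (\<Sum>s<K. real (i choose s) * ((real m - real s) * a s))"
      by (simp add: lessThan_Suc_atMost[symmetric])
    also have "(\<Sum>s\<le>K. real (i choose s) * (real s * a (s - 1)))
        = (\<Sum>s<K. real (i choose Suc s) * (real (Suc s) * a s))"
      by (simp only: lessThan_Suc_atMost[symmetric] sum.lessThan_Suc_shift) simp
    also have "\<dots> = (\<Sum>s<K. real (i choose s) * (real i - real s) * a s)"
      by (simp only: absorb mult.assoc)
    also have "(\<Sum>s<K. real (i choose s) * ((real m - real s) * a s)) - \<dots> = (real m - real i) * g i"
      by (simp add: g_def sum_subtractf[symmetric] sum_distrib_left algebra_simps)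
    finally show ?thesis .
  qed
  have g0: "g i \<ge> 0" for i unfolding g_def using a0 assms by (intro sum_nonneg) auto
  \<comment> \<open>Stopping Newton's formula at \<open>K\<close> drops only nonnegative terms; for
    \<open>i < K\<close> the dropped binomials vanish, which gives \<open>g_eq\<close>.\<close>
  have g_le: "g i \<le> 1 / sqrt (real m - real i)" if "i < m" for i
  proof -
    have "g i = (\<Sum>s\<in>{..<K} \<inter> {..i}. real (i choose s) * a s)"
      unfolding g_def by (rule sum.mono_neutral_right) (auto simp: binomial_eq_0)
    also have "\<dots> \<le> (\<Sum>s\<le>i. real (i choose s) * a s)"
      by (rule sum_mono2) (use a0 that in auto)
    finally show ?thesis by (simp add: newton[OF that])
  qed
  have g_eq: "g i = 1 / sqrt (real m - real i)" if "i < K" for i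
  proof -
    have "(\<Sum>s\<le>i. real (i choose s) * a s) = g i"
      unfolding g_def by (rule sum.mono_neutral_left) (use that in \<open>auto simp: binomial_eq_0\<close>)
    then show ?thesis using newton[of i] that assms by simp
  qed
  have sq: "((real m - real i) * (1 / sqrt (real m - real i)))\<^sup>2 = real m - real i" if "i < m" for i
    using that by (simp add: power_mult_distrib power_divide power2_eq_square)
  show thesis
  proof (rule that[of c])
    fix i assume "i \<le> m"
    show "(\<Sum>s\<le>K. real (i choose s) * c s)\<^sup>2 \<le> real m - real i"
    \<comment> \<open>At \<open>i = m\<close> the factor \<open>m - i\<close> makes both sides
      0.\<close>
    proof (cases "i < m")
      case True
      have "((real m - real i) * g i)\<^sup>2 \<le> ((real m - real i) * (1 / sqrt (real m - real i)))\<^sup>2"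
        using True g0 g_le by (intro power_mono mult_left_mono) auto
      then show ?thesis using sq[OF True] by (simp only: fg[OF \<open>i \<le> m\<close>])
    qed (use fg[OF \<open>i \<le> m\<close>] \<open>i \<le> m\<close> in auto)
  next
    fix i assume "i < K"
    then show "(\<Sum>s\<le>K. real (i choose s) * c s)\<^sup>2 = real m - real i"
      using fg[of i] g_eq[of i] sq[of i] assms by simp
  qed
qed

section \<open>Integer points lift\<close>

definition subcube :: "'d set \<Rightarrow> 'd set \<Rightarrow> (real^'d) set" where
  "subcube S T = restr S 1 \<inter> restr T 0"

lemma subcube_Int: "subcube S T \<inter> subcube S' T' = subcube (S \<union> S') (T \<union> T')"
  by (auto simp: subcube_def restr_def)

lemma subcube_empty: "subcube {} {} = zero_one"
  by (auto simp: subcube_def restr_def)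

lemma subcube_singleton: "subcube {i} {} = restr {i} 1"
  by (auto simp: subcube_def restr_def)

lemma subcube_in_face_family:
  "S \<inter> T = {} \<Longrightarrow> card S + card T \<le> k \<Longrightarrow> subcube S T \<in> face_family k"
  unfolding subcube_def face_family_def by blast

lemma finite_face_family: "finite (face_family k :: (real^'d::finite) set set)"
proof (rule finite_subset)
  show "face_family k \<subseteq> (\<Union>S. \<Union>T. {restr S 1 \<inter> restr T 0})"
    unfolding face_family_def by blast
qed simp

lemma convex_MT:
  fixes ends :: "'d::finite \<Rightarrow> 'v set"
  shows "convex (MT V ends)"
proof (rule convexI)
  fix x y :: "real^'d" and u v :: real
  assume x: "x \<in> MT V ends" and y: "y \<in> MT V ends" and uv: "0 \<le> u" "0 \<le> v" "u + v = 1"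
  have "u * x $ e + v * y $ e \<le> 1" for e
    using convex_bound_le[of "x $ e" 1 "y $ e" u v] x y uv by (simp add: MT_def)
  moreover have "(\<Sum>e | i \<in> ends e. u * x $ e + v * y $ e) \<le> 1" if "i \<in> V" for i
    using convex_bound_le[of "\<Sum>e | i \<in> ends e. x $ e" 1 "\<Sum>e | i \<in> ends e. y $ e" u v] x y uv that
    by (simp add: MT_def sum.distrib sum_distrib_left)
  ultimately show "u *\<^sub>R x + v *\<^sub>R y \<in> MT V ends"
    using x y uv by (auto simp: MT_def)
qed

text \<open>A convex combination with weights \<open>u\<close> of integer points is certified by
  \<open>Y \<alpha> \<beta> = u (\<alpha> \<inter> \<beta>)\<close>.\<close>

lemma int_hull_subset_SA_plus:
  fixes P :: "(real^'d::finite) set"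
  assumes "convex P"
  shows "int_hull P \<subseteq> SA_plus k P"
proof
  fix x assume "x \<in> int_hull P"
  define Z where "Z = P \<inter> zero_one"
  have finZ: "finite Z" by (simp add: Z_def finite_zero_one)
  obtain u where u: "\<And>z. z \<in> Z \<Longrightarrow> 0 \<le> u z" "sum u Z = 1" "(\<Sum>z\<in>Z. u z *\<^sub>R z) = x"
    using \<open>x \<in> int_hull P\<close> finZ by (auto simp: int_hull_def Z_def convex_hull_finite)
  have "Z \<noteq> {}" using u by auto
  \<comment> \<open>The product form shows a nonnegative combination of rank-one matrices, hence
    positive semidefiniteness.\<close>
  define Y where "Y \<alpha> \<beta> = (\<Sum>z\<in>Z. u z * (indicator \<alpha> z * indicator \<beta> z))" for \<alpha> \<beta> :: "(real^'d) set"
  have Y_Int: "Y \<alpha> \<beta> = sum u (Z \<inter> (\<alpha> \<inter> \<beta>))" for \<alpha> \<beta>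
    unfolding Y_def sum.inter_restrict[OF finZ] by (rule sum.cong) (auto simp: indicator_def)
  have hat: "hat_vec (\<lambda>\<beta>. Y \<beta> \<alpha>) = (sum u (Z \<inter> \<alpha>), \<Sum>z\<in>Z \<inter> \<alpha>. u z *\<^sub>R z)" for \<alpha>
  proof -
    have "Z \<inter> (zero_one \<inter> \<alpha>) = Z \<inter> \<alpha>" by (auto simp: Z_def)
    moreover have "sum u (Z \<inter> (restr {i} 1 \<inter> \<alpha>)) = (\<Sum>z\<in>Z \<inter> \<alpha>. u z * z $ i)" for i
    proof -
      have "sum u (Z \<inter> (restr {i} 1 \<inter> \<alpha>)) = (\<Sum>z\<in>Z \<inter> (restr {i} 1 \<inter> \<alpha>). u z * z $ i)"
        by (rule sum.cong) (auto simp: restr_def)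
      also have "\<dots> = (\<Sum>z\<in>Z \<inter> \<alpha>. u z * z $ i)"
        by (rule sum.mono_neutral_left) (use finZ in \<open>auto simp: Z_def restr_def zero_one_def\<close>)
      finally show ?thesis .
    qed
    ultimately show ?thesis by (simp add: hat_vec_def Y_Int vec_eq_iff)
  qed
  have cone: "hat_vec (\<lambda>\<beta>. Y \<beta> \<alpha>) \<in> homog_cone P" for \<alpha>
  \<comment> \<open>Even the zero vector lies in the cone only if \<open>P\<close> has a point,
    which \<open>Z\<close> supplies. For positive mass, normalizing gives a convex combination of
    points of \<open>P\<close>.\<close>
  proof (cases "sum u (Z \<inter> \<alpha>) = 0")
    case True
    then have "u z = 0" if "z \<in> Z \<inter> \<alpha>" for z
      using sum_nonneg_eq_0_iff[of "Z \<inter> \<alpha>" u] finZ u that by auto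
    then have "hat_vec (\<lambda>\<beta>. Y \<beta> \<alpha>) = (0, 0)" by (simp add: hat)
    moreover obtain z where "z \<in> Z" using \<open>Z \<noteq> {}\<close> by blast
    ultimately show ?thesis
      by (auto simp: homog_cone_def Z_def intro!: exI[of _ z])
  next
    case False
    define l where "l = sum u (Z \<inter> \<alpha>)"
    have l: "l > 0" using False u sum_nonneg[of "Z \<inter> \<alpha>" u] by (simp add: l_def order_less_le)
    have "(\<Sum>z\<in>Z \<inter> \<alpha>. (u z / l) *\<^sub>R z) \<in> P"
    proof (rule convex_sum)
      show "(\<Sum>z\<in>Z \<inter> \<alpha>. u z / l) = 1" using l by (simp add: sum_divide_distrib[symmetric] l_def)
    qed (use finZ assms u l in \<open>auto simp: Z_def\<close>)
    moreover have "(\<Sum>z\<in>Z \<inter> \<alpha>. u z *\<^sub>R z) = l *\<^sub>R (\<Sum>z\<in>Z \<inter> \<alpha>. (u z / l) *\<^sub>R z)"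
      using l by (simp add: scaleR_sum_right)
    ultimately show ?thesis
      unfolding hat homog_cone_def using l by (auto simp: l_def[symmetric])
  qed
  have psd: "symmetric_psd_on (face_family k) Y"
    unfolding symmetric_psd_on_def
  proof (intro conjI ballI allI)
    fix v :: "(real^'d) set \<Rightarrow> real"
    let ?A = "face_family k :: (real^'d) set set"
    have "(\<Sum>a\<in>?A. \<Sum>b\<in>?A. v a * Y a b * v b)
        = (\<Sum>a\<in>?A. \<Sum>b\<in>?A. \<Sum>z\<in>Z. u z * ((v a * indicator a z) * (v b * indicator b z)))"
      by (simp add: Y_def sum_distrib_left sum_distrib_right algebra_simps)
    also have "\<dots> = (\<Sum>a\<in>?A. \<Sum>z\<in>Z. \<Sum>b\<in>?A. u z * ((v a * indicator a z) * (v b * indicator b z)))"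
      by (intro sum.cong refl) (rule sum.swap)
    also have "\<dots> = (\<Sum>z\<in>Z. \<Sum>a\<in>?A. \<Sum>b\<in>?A. u z * ((v a * indicator a z) * (v b * indicator b z)))"
      by (rule sum.swap)
    also have "\<dots> = (\<Sum>z\<in>Z. u z * (\<Sum>a\<in>?A. v a * indicator a z)\<^sup>2)"
      unfolding power2_eq_square sum_product by (simp only: sum_distrib_left)
    also have "\<dots> \<ge> 0" using u by (intro sum_nonneg) auto
    finally show "0 \<le> (\<Sum>a\<in>?A. \<Sum>b\<in>?A. v a * Y a b * v b)" .
  qed (simp add: Y_Int Int_commute)
  have split: "Y \<beta> (\<alpha> \<inter> restr {j} 1) + Y \<beta> (\<alpha> \<inter> restr {j} 0) = Y \<beta> \<alpha>" for \<alpha> \<beta> j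
  proof -
    have "sum u (Z \<inter> (\<beta> \<inter> \<alpha>))
        = sum u (Z \<inter> (\<beta> \<inter> (\<alpha> \<inter> restr {j} 1)) \<union> Z \<inter> (\<beta> \<inter> (\<alpha> \<inter> restr {j} 0)))"
      by (rule arg_cong[where f = "sum u"]) (auto simp: Z_def restr_def zero_one_def)
    also have "\<dots> = sum u (Z \<inter> (\<beta> \<inter> (\<alpha> \<inter> restr {j} 1))) + sum u (Z \<inter> (\<beta> \<inter> (\<alpha> \<inter> restr {j} 0)))"
      using finZ by (intro sum.union_disjoint) (auto simp: restr_def)
    finally show ?thesis by (simp add: Y_Int)
  qed
  have "Y \<alpha> \<beta> = 0" if "(convex hull \<alpha>) \<inter> (convex hull \<beta>) \<inter> P = {}" for \<alpha> \<beta>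
  proof -
    have "Z \<inter> (\<alpha> \<inter> \<beta>) = {}"
      using that hull_subset[of \<alpha> convex] hull_subset[of \<beta> convex] by (auto simp: Z_def)
    then show ?thesis by (simp add: Y_Int)
  qed
  moreover have "Y zero_one zero_one = 1" using u by (simp add: Y_Int Z_def Int_assoc)
  moreover have "0 \<le> Y \<alpha> \<beta>" for \<alpha> \<beta> using u by (auto simp: Y_Int intro!: sum_nonneg)
  ultimately have "Y \<in> SA_plus_lift k P"
    unfolding SA_plus_lift_def mem_Collect_eq
    using psd cone split by (intro conjI allI ballI impI) (simp_all add: Y_Int)
  moreover have "hat_vec (\<lambda>\<beta>. Y \<beta> zero_one) = (1, x)"
    using u by (simp add: hat Z_def Int_assoc)
  ultimately show "x \<in> SA_plus k P" unfolding SA_plus_def by blast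
qed

section \<open>Moments of a lifted matrix\<close>

text \<open>Fill the budget \<open>a\<close> from \<open>S\<close> first, then from
  \<open>T\<close>. This distributes up to \<open>2 * k\<close> conditions over a row index and a
  column index.\<close>

lemma ex_split_card_le:
  assumes "finite S" "finite T" "card S + card T \<le> a + b"
  obtains S1 T1 where "S1 \<subseteq> S" "T1 \<subseteq> T" "card S1 + card T1 \<le> a"
    "card (S - S1) + card (T - T1) \<le> b"
proof -
  obtain S1 where S1: "S1 \<subseteq> S" "card S1 = min a (card S)"
    by (meson obtain_subset_with_card_n min.cobounded2)
  obtain T1 where T1: "T1 \<subseteq> T" "card T1 = min (a - card S1) (card T)"
    by (meson obtain_subset_with_card_n min.cobounded2)
  have S2: "card (S - S1) = card S - card S1"
    by (rule card_Diff_subset[OF finite_subset[OF S1(1) assms(1)] S1(1)])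
  have T2: "card (T - T1) = card T - card T1"
    by (rule card_Diff_subset[OF finite_subset[OF T1(1) assms(2)] T1(1)])
  have "card S1 + card T1 \<le> a" using S1(2) T1(2) by linarith
  moreover have "card (S - S1) + card (T - T1) \<le> b" using S1(2) T1(2) S2 T2 assms(3) by linarith
  ultimately show thesis using that S1(1) T1(1) by blast
qed

section \<open>Inclusion-exclusion for set functions\<close>

lemma inj_on_insert_Pow: "j \<notin> T \<Longrightarrow> inj_on (insert j) (Pow T)"
  by (rule inj_on_inverseI[of _ "\<lambda>U. U - {j}"]) auto

text \<open>If \<open>y S\<close> is the mass of the supersets of \<open>S\<close>, inclusion-exclusion makes this the mass of the
  supersets of \<open>S\<close> that are disjoint from \<open>T\<close>.\<close>

definition alternating_sum :: "('a set \<Rightarrow> real) \<Rightarrow> 'a set \<Rightarrow> 'a set \<Rightarrow> real" where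
  "alternating_sum y S T = (\<Sum>U\<in>Pow T. (-1) ^ card U * y (S \<union> U))"

lemma alternating_sum_empty: "alternating_sum y S {} = y S"
  by (simp add: alternating_sum_def)

text \<open>Subsets split by membership of \<open>j\<close>, which flips the sign. Moments obey the
  same recursion by \<open>moment_split\<close>.\<close>

lemma alternating_sum_insert:
  assumes "finite T" "j \<notin> T"
  shows "alternating_sum y S (insert j T) = alternating_sum y S T - alternating_sum y (insert j S) T"
proof -
  have "alternating_sum y S (insert j T)
      = alternating_sum y S T + (\<Sum>U\<in>insert j ` Pow T. (-1) ^ card U * y (S \<union> U))"
    unfolding alternating_sum_def Pow_insert
    by (rule sum.union_disjoint) (use assms in auto)
  also have "(\<Sum>U\<in>insert j ` Pow T. (-1) ^ card U * y (S \<union> U))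
      = (\<Sum>U\<in>Pow T. (-1) ^ card (insert j U) * y (S \<union> insert j U))"
    using inj_on_insert_Pow[OF assms(2)] by (rule sum.reindex_cong) auto
  also have "\<dots> = (\<Sum>U\<in>Pow T. - ((-1) ^ card U * y (insert j S \<union> U)))"
  proof (rule sum.cong)
    fix U assume "U \<in> Pow T"
    then have "finite U" "j \<notin> U" using assms finite_subset by auto
    then show "(-1) ^ card (insert j U) * y (S \<union> insert j U) = - ((-1) ^ card U * y (insert j S \<union> U))"
      by simp
  qed simp
  finally show ?thesis by (simp add: alternating_sum_def sum_negf)
qed

text \<open>Law of total mass: classify sets by their trace \<open>U\<close> on
  \<open>R\<close>.\<close>

lemma alternating_sum_partition:
  assumes "finite R" "finite T" "R \<inter> T = {}"
  shows "alternating_sum y S T = (\<Sum>U\<in>Pow R. alternating_sum y (S \<union> U) (T \<union> (R - U)))"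
  using assms
proof (induction R arbitrary: S)
  case (insert j R)
  let ?g = "\<lambda>U. alternating_sum y (S \<union> U) (T \<union> (insert j R - U))"
  have "(\<Sum>U\<in>Pow (insert j R). ?g U) = sum ?g (Pow R) + sum ?g (insert j ` Pow R)"
    unfolding Pow_insert by (rule sum.union_disjoint) (use insert in auto)
  also have "sum ?g (insert j ` Pow R) = (\<Sum>U\<in>Pow R. ?g (insert j U))"
    using inj_on_insert_Pow[OF insert.hyps(2)] by (rule sum.reindex_cong) auto
  also have "sum ?g (Pow R) + (\<Sum>U\<in>Pow R. ?g (insert j U))
      = (\<Sum>U\<in>Pow R. alternating_sum y (S \<union> U) (T \<union> (R - U)))"
    unfolding sum.distrib[symmetric]
  proof (rule sum.cong)
    fix U assume "U \<in> Pow R"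
    then have U: "insert j R - U = insert j (R - U)" "insert j R - insert j U = R - U"
      using insert by auto
    have "j \<notin> T \<union> (R - U)" "finite (T \<union> (R - U))" using insert by auto
    from alternating_sum_insert[OF this(2,1), of y "S \<union> U"]
    show "?g U + ?g (insert j U) = alternating_sum y (S \<union> U) (T \<union> (R - U))"
      by (simp add: U)
  qed simp
  also have "\<dots> = alternating_sum y S T" using insert by simp
  finally show ?case by simp
qed simp

text \<open>Moebius inversion: on subsets of \<open>F\<close>, every \<open>y\<close> is the
  superset sum of a signed measure, whose atoms are these alternating sums.\<close>

lemma sum_supersets_alternating_sum:
  assumes "finite F" "S \<subseteq> F"
  shows "y S = (\<Sum>M\<in>Pow F. if S \<subseteq> M then alternating_sum y M (F - M) else 0)"
proof -
  have "y S = (\<Sum>U\<in>Pow (F - S). alternating_sum y (S \<union> U) (F - S - U))"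
    using alternating_sum_partition[of "F - S" "{}" y S] assms by (simp add: alternating_sum_empty)
  also have "\<dots> = (\<Sum>M\<in>{M\<in>Pow F. S \<subseteq> M}. alternating_sum y M (F - M))"
    by (rule sum.reindex_bij_witness[of _ "\<lambda>M. M - S" "\<lambda>U. S \<union> U"])
      (use assms in \<open>auto simp: Diff_eq Un_absorb1 intro!: arg_cong[where f = "alternating_sum y _"]\<close>)
  finally show ?thesis using assms by (simp only: sum.inter_filter finite_Pow_iff)
qed

text \<open>A polynomial in \<open>card M\<close> of degree at most \<open>K\<close> becomes a
  combination of indicators of \<open>S \<subseteq> M\<close> with \<open>card S \<le> K\<close>,
  and such sets can index a test vector for the matrix.\<close>

lemma sum_card_eq_binomial:
  assumes "finite F" "M \<subseteq> F"
  shows "(\<Sum>S\<in>{S\<in>Pow F. card S \<le> K}. if S \<subseteq> M then c (card S) else 0)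
    = (\<Sum>s\<le>K. real (card M choose s) * c s)"
proof -
  have finM: "finite M" using assms finite_subset by blast
  have "(\<Sum>S\<in>{S\<in>Pow F. card S \<le> K}. if S \<subseteq> M then c (card S) else 0)
      = (\<Sum>S\<in>{S\<in>Pow M. card S \<le> K}. c (card S))"
    by (rule sum.mono_neutral_cong_right) (use assms in auto)
  also have "\<dots> = (\<Sum>s\<le>K. \<Sum>S\<in>{S\<in>{S\<in>Pow M. card S \<le> K}. card S = s}. c (card S))"
    by (rule sum.group[symmetric]) (use finM in auto)
  also have "\<dots> = (\<Sum>s\<le>K. real (card M choose s) * c s)"
  proof (rule sum.cong)
    fix s assume "s \<in> {..K}"
    then have "{S\<in>{S\<in>Pow M. card S \<le> K}. card S = s} = {S. S \<subseteq> M \<and> card S = s}" by auto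
    then show "(\<Sum>S\<in>{S\<in>{S\<in>Pow M. card S \<le> K}. card S = s}. c (card S)) = real (card M choose s) * c s"
      using n_subsets[OF finM, of s] by simp
  qed simp
  finally show ?thesis .
qed

text \<open>A matching of size \<open>m - r\<close> leaves \<open>2 * r + 1\<close> vertices of
  \<open>W\<close> uncovered, and these span at most \<open>(2 * r + 1) choose 2\<close>
  edges.\<close>

lemma card_edges_avoiding_le:
  fixes ends :: "'d::finite \<Rightarrow> 'v set"
  assumes card2: "\<And>e. card (ends e) = 2" and "inj ends" and "finite W" "card W = 2 * m + 1"
    and M: "is_matching ends M" "\<And>e. e \<in> M \<Longrightarrow> ends e \<subseteq> W"
  shows "card M \<le> m"
    and "card {e. ends e \<subseteq> W \<and> ends e \<inter> covered ends M = {}} \<le> (m - card M) * (2 * (m - card M) + 1)"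
proof -
  have cov: "covered ends M \<subseteq> W" using M by (auto simp: covered_def)
  have cc: "card (covered ends M) = 2 * card M" using card_covered[of M ends] M card2 by simp
  then show le: "card M \<le> m" using card_mono[OF \<open>finite W\<close> cov] assms(4) by simp
  have "finite (covered ends M)" using cov \<open>finite W\<close> finite_subset by blast
  then have cW: "card (W - covered ends M) = 2 * (m - card M) + 1"
    using card_Diff_subset[of "covered ends M" W] cov cc assms(4) le by simp
  have fin: "finite (W - covered ends M)" using \<open>finite W\<close> by simp
  have "card {e. ends e \<subseteq> W \<and> ends e \<inter> covered ends M = {}}
      = card (ends ` {e. ends e \<subseteq> W \<and> ends e \<inter> covered ends M = {}})"
    using \<open>inj ends\<close> by (intro card_image[symmetric]) (auto intro: inj_on_subset)
  also have "\<dots> \<le> card {B. B \<subseteq> W - covered ends M \<and> card B = 2}"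
    by (rule card_mono) (use fin card2 in auto)
  also have "\<dots> = (2 * (m - card M) + 1) choose 2"
    by (simp only: n_subsets[OF fin] cW)
  also have "\<dots> = (m - card M) * (2 * (m - card M) + 1)"
    by (simp add: choose_two)
  finally show "card {e. ends e \<subseteq> W \<and> ends e \<inter> covered ends M = {}}
    \<le> (m - card M) * (2 * (m - card M) + 1)" .
qed

section \<open>Sign, splitting, vanishing and quadratic forms of moments\<close>

context
  fixes k :: nat and P :: "(real^'d::finite) set"
    and Y :: "(real^'d) set \<Rightarrow> (real^'d) set \<Rightarrow> real"
  assumes Y: "Y \<in> SA_plus_lift k P"
begin

text \<open>Condition (5) makes the choice of \<open>\<alpha>\<close> and \<open>\<beta>\<close> irrelevant. Suitable \<open>\<alpha>\<close>, \<open>\<beta>\<close> exist for disjoint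
  \<open>S\<close>, \<open>T\<close> with \<open>card S + card T \<le> 2 * k\<close>; otherwise the value may be arbitrary.\<close>

definition moment :: "'d set \<Rightarrow> 'd set \<Rightarrow> real" where
  "moment S T = (SOME r. \<exists>\<alpha>\<in>face_family k. \<exists>\<beta>\<in>face_family k. \<alpha> \<inter> \<beta> = subcube S T \<and> r = Y \<alpha> \<beta>)"

lemma moment_eq:
  assumes "\<alpha> \<in> face_family k" "\<beta> \<in> face_family k" "\<alpha> \<inter> \<beta> = subcube S T"
  shows "moment S T = Y \<alpha> \<beta>"
proof -
  have "\<exists>\<alpha>'\<in>face_family k. \<exists>\<beta>'\<in>face_family k. \<alpha>' \<inter> \<beta>' = subcube S T \<and> moment S T = Y \<alpha>' \<beta>'"
    unfolding moment_def by (rule someI_ex) (use assms in blast)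
  then obtain \<alpha>' \<beta>' where "\<alpha>' \<in> face_family k" "\<beta>' \<in> face_family k" "\<alpha>' \<inter> \<beta>' = \<alpha> \<inter> \<beta>"
    "moment S T = Y \<alpha>' \<beta>'" using assms by metis
  moreover have "\<forall>\<alpha>1\<in>face_family k. \<forall>\<alpha>2\<in>face_family k. \<forall>\<beta>1\<in>face_family k. \<forall>\<beta>2\<in>face_family k.
      \<alpha>1 \<inter> \<beta>1 = \<alpha>2 \<inter> \<beta>2 \<longrightarrow> Y \<alpha>1 \<beta>1 = Y \<alpha>2 \<beta>2"
    using Y unfolding SA_plus_lift_def mem_Collect_eq by (elim conjE)
  ultimately show ?thesis using assms(1,2) by metis
qed

lemma moment_subcubes:
  assumes "S1 \<inter> T1 = {}" "card S1 + card T1 \<le> k" "S2 \<inter> T2 = {}" "card S2 + card T2 \<le> k"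
  shows "moment (S1 \<union> S2) (T1 \<union> T2) = Y (subcube S1 T1) (subcube S2 T2)"
  by (rule moment_eq[OF subcube_in_face_family[OF assms(1,2)] subcube_in_face_family[OF assms(3,4)]
      subcube_Int])

lemma moment_nonneg:
  assumes "S \<inter> T = {}" "card S + card T \<le> 2 * k"
  shows "0 \<le> moment S T"
proof -
  have "card S + card T \<le> k + k" using assms by simp
  then obtain S1 T1 where ST: "S1 \<subseteq> S" "T1 \<subseteq> T" "card S1 + card T1 \<le> k" "card (S - S1) + card (T - T1) \<le> k"
    by (rule ex_split_card_le[OF finite finite])
  have disj: "S1 \<inter> T1 = {}" "(S - S1) \<inter> (T - T1) = {}" using ST assms by auto
  have "moment S T = Y (subcube S1 T1) (subcube (S - S1) (T - T1))"
    using moment_subcubes[OF disj(1) ST(3) disj(2) ST(4)] ST by (simp add: Un_absorb1)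
  moreover have "\<forall>\<alpha>\<in>face_family k. hat_vec (\<lambda>\<beta>. Y \<beta> \<alpha>) \<in> homog_cone P \<and> (\<forall>\<beta>\<in>face_family k. 0 \<le> Y \<beta> \<alpha>)"
    using Y unfolding SA_plus_lift_def mem_Collect_eq by (elim conjE)
  ultimately show ?thesis using ST disj subcube_in_face_family by metis
qed

lemma moment_split:
  assumes "S \<inter> T = {}" "j \<notin> S \<union> T" "card S + card T < 2 * k"
  shows "moment S T = moment (insert j S) T + moment S (insert j T)"
proof -
  \<comment> \<open>One unit of the column index is kept free, so that \<open>j\<close> can be added
    to it within size \<open>k\<close>.\<close>
  have "card S + card T \<le> (k - 1) + k" using assms by simp
  then obtain S1 T1 where ST: "S1 \<subseteq> S" "T1 \<subseteq> T" "card S1 + card T1 \<le> k - 1"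
    "card (S - S1) + card (T - T1) \<le> k"
    by (rule ex_split_card_le[OF finite finite])
  define \<beta> where "\<beta> = subcube (S - S1) (T - T1)"
  have disj: "S1 \<inter> T1 = {}" "(S - S1) \<inter> (T - T1) = {}" and j: "j \<notin> S1 \<union> T1"
    using ST assms by auto
  have \<beta>: "\<beta> \<in> face_family k" using ST disj by (simp add: \<beta>_def subcube_in_face_family)
  have k: "k > 0" using assms by simp
  have cards: "card (insert j S1) + card T1 \<le> k" "card S1 + card (insert j T1) \<le> k" "card S1 + card T1 \<le> k"
    using ST k j by auto
  have "\<forall>S T j. S \<inter> T = {} \<longrightarrow> card S + card T \<le> k - 1 \<longrightarrow> j \<notin> S \<union> T \<longrightarrow>
      (\<forall>\<beta>\<in>face_family k.
         Y \<beta> (restr S 1 \<inter> restr T 0 \<inter> restr {j} 1) + Y \<beta> (restr S 1 \<inter> restr T 0 \<inter> restr {j} 0)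
           = Y \<beta> (restr S 1 \<inter> restr T 0))"
    using Y by (simp add: SA_plus_lift_def)
  then have "Y \<beta> (restr S1 1 \<inter> restr T1 0 \<inter> restr {j} 1) + Y \<beta> (restr S1 1 \<inter> restr T1 0 \<inter> restr {j} 0)
      = Y \<beta> (restr S1 1 \<inter> restr T1 0)"
    using disj ST j \<beta> by blast
  moreover have "restr S1 1 \<inter> restr T1 0 \<inter> restr {j} 1 = subcube (insert j S1) T1"
    "restr S1 1 \<inter> restr T1 0 \<inter> restr {j} 0 = subcube S1 (insert j T1)"
    "restr S1 1 \<inter> restr T1 0 = subcube S1 T1"
    by (auto simp: subcube_def restr_def)
  moreover have "insert j S1 \<inter> T1 = {}" "S1 \<inter> insert j T1 = {}" using disj j by auto
  moreover have "S - S1 \<union> S1 = S" "T - T1 \<union> T1 = T" "S - S1 \<union> insert j S1 = insert j S"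
    "T - T1 \<union> insert j T1 = insert j T" using ST by auto
  ultimately show ?thesis
    using moment_subcubes[OF disj(2) ST(4), of S1 T1] moment_subcubes[OF disj(2) ST(4), of "insert j S1" T1]
      moment_subcubes[OF disj(2) ST(4), of S1 "insert j T1"] cards disj
    by (simp add: \<beta>_def)
qed

text \<open>Taking the convex hull of a subcube keeps its fixed coordinates fixed. A point of
  \<open>P\<close> in both hulls would therefore have all coordinates in \<open>S\<close> equal to
  1, and the convex hull condition of the lift applies.\<close>

lemma moment_eq_0:
  assumes "card S \<le> 2 * k" "\<And>x. x \<in> P \<Longrightarrow> \<exists>i\<in>S. x $ i \<noteq> 1"
  shows "moment S {} = 0"
proof -
  have "card S + card ({} :: 'd set) \<le> k + k" using assms(1) by simp
  then obtain S1 T1 :: "'d set"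
    where "S1 \<subseteq> S" "T1 \<subseteq> {}" "card S1 + card T1 \<le> k" "card (S - S1) + card ({} - T1) \<le> k"
    by (rule ex_split_card_le[OF finite finite])
  then have S1: "S1 \<subseteq> S" "card S1 \<le> k" "card (S - S1) \<le> k" by auto
  have hull: "convex hull (subcube A {}) \<subseteq> {x. \<forall>i\<in>A. x $ i = 1}" for A :: "'d set"
  proof (rule hull_minimal)
    show "convex {x::real^'d. \<forall>i\<in>A. x $ i = 1}"
      by (rule convexI) simp
  qed (auto simp: subcube_def restr_def)
  have "(convex hull (subcube S1 {})) \<inter> (convex hull (subcube (S - S1) {})) \<inter> P = {}"
    using hull[of S1] hull[of "S - S1"] assms(2) by blast
  moreover have "\<forall>\<alpha>\<in>face_family k. \<forall>\<beta>\<in>face_family k.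
      (convex hull \<alpha>) \<inter> (convex hull \<beta>) \<inter> P = {} \<longrightarrow> Y \<alpha> \<beta> = 0"
    using Y by (simp add: SA_plus_lift_def)
  moreover have "subcube S1 {} \<in> face_family k" "subcube (S - S1) {} \<in> face_family k"
    using S1 by (simp_all add: subcube_in_face_family)
  ultimately have "Y (subcube S1 {}) (subcube (S - S1) {}) = 0" by blast
  then show ?thesis
    using moment_subcubes[of S1 "{}" "S - S1" "{}"] S1 by (simp add: Un_absorb1)
qed

lemma moment_empty: "moment {} {} = 1"
proof -
  have "Y zero_one zero_one = 1" using Y by (simp add: SA_plus_lift_def)
  then show ?thesis using moment_subcubes[of "{}" "{}" "{}" "{}"] by (simp add: subcube_empty)
qed

lemma moment_quadratic_form_nonneg:
  assumes "\<And>S. S \<in> \<S> \<Longrightarrow> card S \<le> k"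
  shows "0 \<le> (\<Sum>S\<in>\<S>. \<Sum>T\<in>\<S>. c S * c T * moment (S \<union> T) {})"
proof -
  let ?A = "face_family k :: (real^'d) set set"
  \<comment> \<open>Collecting the coefficients over all \<open>S\<close> with the same subcube
    pushes \<open>c\<close> forward to matrix indices without inverting
    \<open>S \<mapsto> subcube S {}\<close>.\<close>
  define v where "v \<alpha> = (\<Sum>S\<in>\<S>. if \<alpha> = subcube S {} then c S else 0)" for \<alpha>
  have mem: "subcube S {} \<in> ?A" if "S \<in> \<S>" for S
    using assms[OF that] by (simp add: subcube_in_face_family)
  have ev: "(\<Sum>\<alpha>\<in>?A. v \<alpha> * g \<alpha>) = (\<Sum>S\<in>\<S>. c S * g (subcube S {}))" for g
  proof -
    have "(\<Sum>\<alpha>\<in>?A. v \<alpha> * g \<alpha>) = (\<Sum>\<alpha>\<in>?A. \<Sum>S\<in>\<S>. if \<alpha> = subcube S {} then c S * g \<alpha> else 0)"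
      unfolding v_def sum_distrib_right by (intro sum.cong refl) auto
    also have "\<dots> = (\<Sum>S\<in>\<S>. \<Sum>\<alpha>\<in>?A. if \<alpha> = subcube S {} then c S * g \<alpha> else 0)"
      by (rule sum.swap)
    also have "\<dots> = (\<Sum>S\<in>\<S>. c S * g (subcube S {}))"
      by (rule sum.cong) (use mem in \<open>auto simp: finite_face_family\<close>)
    finally show ?thesis .
  qed
  have Y_moment: "c S * (c T * Y (subcube S {}) (subcube T {})) = c S * c T * moment (S \<union> T) {}"
    if "S \<in> \<S>" "T \<in> \<S>" for S T
    using moment_subcubes[of S "{}" T "{}"] assms that by simp
  have "symmetric_psd_on ?A Y" using Y by (simp add: SA_plus_lift_def)
  then have "0 \<le> (\<Sum>a\<in>?A. \<Sum>b\<in>?A. v a * Y a b * v b)"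
    unfolding symmetric_psd_on_def by blast
  also have "\<dots> = (\<Sum>a\<in>?A. v a * (\<Sum>b\<in>?A. v b * Y a b))"
    unfolding sum_distrib_left by (intro sum.cong refl) (simp add: ac_simps)
  also have "\<dots> = (\<Sum>S\<in>\<S>. c S * (\<Sum>T\<in>\<S>. c T * Y (subcube S {}) (subcube T {})))"
    by (simp only: ev)
  also have "\<dots> = (\<Sum>S\<in>\<S>. \<Sum>T\<in>\<S>. c S * c T * moment (S \<union> T) {})"
    unfolding sum_distrib_left using Y_moment by (intro sum.cong refl)
  finally show ?thesis .
qed

end

section \<open>Blossom inequalities from the lift\<close>

text \<open>The blossom inequality of \<open>W\<close>, since single-edge moments are the
  coordinates of the projected point. The last condition on \<open>K\<close> keeps the mass of each
  matching with at least \<open>K\<close> edges within reach of \<open>2 * k\<close>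
  conditions.\<close>

lemma sum_moment_le:
  fixes ends :: "'d::finite \<Rightarrow> 'v set"
  assumes card2: "\<And>e. card (ends e) = 2" and inj: "inj ends" and V: "\<And>e. ends e \<subseteq> V"
    and Y: "Y \<in> SA_plus_lift k (MT V ends)"
    and W: "finite W" "card W = 2 * m + 1"
    and K: "K \<le> k" "K \<le> m" "2 * ((m - K) * (m - K + 1)) \<le> m"
  shows "(\<Sum>e | ends e \<subseteq> W. moment k Y {e} {}) \<le> real m"
proof -
  define F where "F = {e. ends e \<subseteq> W}"
  \<comment> \<open>Beyond size \<open>2 * k\<close> moments carry no information. Setting
    \<open>y\<close> to 0 off the matchings agrees with the moments up to that size and concentrates
    \<open>p\<close> on matchings.\<close>
  define y where "y S = (if is_matching ends S then moment k Y S {} else 0)" for S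
  define p where "p M = alternating_sum y M (F - M)" for M
  define d where "d = m - K"
  have "2 * d * 1 \<le> 2 * (d * (d + 1))" by simp
  then have mK: "m \<le> 2 * K" using K by (simp add: d_def)
  have FW: "\<And>M e. M \<subseteq> F \<Longrightarrow> e \<in> M \<Longrightarrow> ends e \<subseteq> W" by (auto simp: F_def)
  have nonmatching: "moment k Y S {} = 0" if S: "\<not> is_matching ends S" "card S \<le> 2 * k" for S
  proof (rule moment_eq_0[OF Y S(2)])
    fix x assume x: "x \<in> MT V ends"
    obtain e e' v where e: "e \<in> S" "e' \<in> S" "e \<noteq> e'" "v \<in> ends e" "v \<in> ends e'"
      using S by (auto simp: is_matching_def)
    have "x $ e + x $ e' = (\<Sum>e\<in>{e, e'}. x $ e)" using e by simp
    also have "\<dots> \<le> (\<Sum>e | v \<in> ends e. x $ e)"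
      by (rule sum_mono2) (use e x in \<open>auto simp: MT_def\<close>)
    also have "\<dots> \<le> 1" using x e V by (auto simp: MT_def)
    finally have "x $ e \<noteq> 1 \<or> x $ e' \<noteq> 1" by linarith
    then show "\<exists>i\<in>S. x $ i \<noteq> 1" using e by blast
  qed
  have y_eq: "y S = moment k Y S {}" if "card S \<le> 2 * k" for S
    using nonmatching[OF _ that] by (simp add: y_def)
  have alt_eq: "alternating_sum y S T = moment k Y S T"
    if "S \<inter> T = {}" "card S + card T \<le> 2 * k" for S T
  proof -
    have "finite T" by simp
    then show ?thesis using that
    proof (induction T arbitrary: S)
      case empty
      then show ?case by (simp add: alternating_sum_empty y_eq)
    next
      case (insert j T)
      have "moment k Y S T = moment k Y (insert j S) T + moment k Y S (insert j T)"
        by (rule moment_split[OF Y]) (use insert in auto)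
      moreover have "card (insert j S) + card T \<le> 2 * k" using insert by simp
      ultimately show ?case
        using insert.IH[of S] insert.IH[of "insert j S"] insert.hyps insert.prems
        by (simp add: alternating_sum_insert)
    qed
  qed
  have p0: "p M = 0" if "\<not> is_matching ends M" for M
  proof -
    have "y (M \<union> U) = 0" for U using that is_matching_subset[of ends "M \<union> U" M] by (auto simp: y_def)
    then show ?thesis by (simp add: p_def alternating_sum_def)
  qed
  have p_nonneg: "0 \<le> p M" if M: "M \<subseteq> F" "is_matching ends M" and KM: "K \<le> card M" for M
  proof -
    define T where "T = {e. ends e \<subseteq> W \<and> ends e \<inter> covered ends M = {}}"
    define r where "r = m - card M"
    have Mm: "card M \<le> m" and cT: "card T \<le> r * (2 * r + 1)"
      using card_edges_avoiding_le[OF card2 inj W M(2)] FW[OF M(1)] by (simp_all add: T_def r_def)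
    have "ends e \<noteq> {}" for e using card2[of e] by auto
    then have TM: "T \<subseteq> F - M" by (auto simp: T_def F_def covered_def)
    \<comment> \<open>An edge of \<open>F - M\<close> outside \<open>T\<close> touches a vertex
      covered by \<open>M\<close>, so every \<open>U\<close> containing one has
      \<open>y (M \<union> U) = 0\<close>: only the edges of \<open>T\<close> need to be
      forbidden.\<close>
    have pT: "p M = alternating_sum y M T"
      unfolding p_def alternating_sum_def
    proof (rule sum.mono_neutral_right)
      show "\<forall>U\<in>Pow (F - M) - Pow T. (-1) ^ card U * y (M \<union> U) = 0"
      proof
        fix U assume "U \<in> Pow (F - M) - Pow T"
        then obtain e where e: "e \<in> U" "e \<notin> T" "e \<in> F" "e \<notin> M" by auto
        then obtain e' where "e' \<in> M" "ends e \<inter> ends e' \<noteq> {}" by (auto simp: T_def F_def covered_def)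
        then have "\<not> is_matching ends (M \<union> U)" using e by (force simp: is_matching_def)
        then show "(-1) ^ card U * y (M \<union> U) = 0" by (simp add: y_def)
      qed
    qed (use TM in auto)
    \<comment> \<open>The count is \<open>card M + card T \<le> m + 2 * r * r \<le> m + 2 * d * d
      \<le> 2 * m - 2 * d = 2 * K\<close>.\<close>
    have "r \<le> d" using KM by (simp add: r_def d_def)
    then have "2 * (r * r) \<le> 2 * (d * d)" by (simp add: mult_mono)
    moreover have "2 * (d * d) + 2 * d \<le> m" using K(3) by (simp add: d_def algebra_simps)
    moreover have "m = card M + r" "m = K + d" using Mm K by (simp_all add: r_def d_def)
    ultimately have "card M + card T \<le> 2 * k" using cT K(1) by (simp add: algebra_simps)
    moreover have "M \<inter> T = {}" using TM by auto
    ultimately show ?thesis using pT alt_eq moment_nonneg[OF Y] by simp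
  qed
  have y_sum: "y S = (\<Sum>M\<in>Pow F. if S \<subseteq> M then p M else 0)" if "S \<subseteq> F" for S
    unfolding p_def by (rule sum_supersets_alternating_sum) (use that in auto)
  obtain c where c_le: "\<And>i. i \<le> m \<Longrightarrow> (\<Sum>s\<le>K. real (i choose s) * c s)\<^sup>2 \<le> real m - real i"
    and c_eq: "\<And>i. i < K \<Longrightarrow> (\<Sum>s\<le>K. real (i choose s) * c s)\<^sup>2 = real m - real i"
    using ex_square_below_linear[OF K(2)] by blast
  define f where "f i = (\<Sum>s\<le>K. real (i choose s) * c s)" for i
  define \<S> where "\<S> = {S\<in>Pow F. card S \<le> K}"
  have f_eq: "(\<Sum>S\<in>\<S>. if S \<subseteq> M then c (card S) else 0) = f (card M)" if "M \<in> Pow F" for M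
    unfolding \<S>_def f_def by (rule sum_card_eq_binomial) (use that in auto)
  have "0 \<le> (\<Sum>S\<in>\<S>. \<Sum>T\<in>\<S>. c (card S) * c (card T) * moment k Y (S \<union> T) {})"
    using moment_quadratic_form_nonneg[OF Y, of \<S> "\<lambda>S. c (card S)"] K by (auto simp: \<S>_def)
  also have "\<dots> = (\<Sum>S\<in>\<S>. \<Sum>T\<in>\<S>. \<Sum>M\<in>Pow F.
      p M * ((if S \<subseteq> M then c (card S) else 0) * (if T \<subseteq> M then c (card T) else 0)))"
  proof (intro sum.cong refl)
    fix S T assume "S \<in> \<S>" "T \<in> \<S>"
    then have "S \<union> T \<subseteq> F" "card (S \<union> T) \<le> 2 * k"
      using K card_Un_le[of S T] by (auto simp: \<S>_def)
    then have "moment k Y (S \<union> T) {} = (\<Sum>M\<in>Pow F. if S \<union> T \<subseteq> M then p M else 0)"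
      using y_eq y_sum by metis
    then show "c (card S) * c (card T) * moment k Y (S \<union> T) {} = (\<Sum>M\<in>Pow F.
        p M * ((if S \<subseteq> M then c (card S) else 0) * (if T \<subseteq> M then c (card T) else 0)))"
      by (auto simp: sum_distrib_left intro!: sum.cong)
  qed
  also have "\<dots> = (\<Sum>S\<in>\<S>. \<Sum>M\<in>Pow F. \<Sum>T\<in>\<S>.
      p M * ((if S \<subseteq> M then c (card S) else 0) * (if T \<subseteq> M then c (card T) else 0)))"
    by (rule sum.cong[OF refl], rule sum.swap)
  also have "\<dots> = (\<Sum>M\<in>Pow F. \<Sum>S\<in>\<S>. \<Sum>T\<in>\<S>.
      p M * ((if S \<subseteq> M then c (card S) else 0) * (if T \<subseteq> M then c (card T) else 0)))"
    by (rule sum.swap)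
  also have "\<dots> = (\<Sum>M\<in>Pow F. p M * (\<Sum>S\<in>\<S>. if S \<subseteq> M then c (card S) else 0)\<^sup>2)"
    unfolding power2_eq_square sum_product by (simp only: sum_distrib_left)
  also have "\<dots> = (\<Sum>M\<in>Pow F. p M * (f (card M))\<^sup>2)"
    by (rule sum.cong[OF refl]) (simp only: f_eq)
  also have "\<dots> \<le> (\<Sum>M\<in>Pow F. p M * (real m - real (card M)))"
  proof (rule sum_mono)
    fix M assume M: "M \<in> Pow F"
    show "p M * (f (card M))\<^sup>2 \<le> p M * (real m - real (card M))"
    \<comment> \<open>Below size \<open>K\<close> the sign of \<open>p M\<close> is unknown, but
      there the square equals \<open>m - card M\<close>. From \<open>K\<close> on,
      \<open>p M\<close> is nonnegative and the inequality suffices; non-matchings have mass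
      0.\<close>
    proof (cases "is_matching ends M \<and> K \<le> card M")
      case True
      have "card M \<le> m" using card_edges_avoiding_le(1)[OF card2 inj W, of M] FW M True by auto
      then show ?thesis using True M p_nonneg c_le by (auto simp: f_def intro!: mult_left_mono)
    qed (use p0 c_eq in \<open>auto simp: f_def not_le\<close>)
  qed
  \<comment> \<open>The total mass is \<open>y {} = 1\<close>, and the expectation of
    \<open>card M\<close> is the sum of the single-edge moments.\<close>
  also have "\<dots> = (\<Sum>M\<in>Pow F. real m * p M) - (\<Sum>M\<in>Pow F. real (card M) * p M)"
    by (simp add: sum_subtractf[symmetric] algebra_simps)
  also have "(\<Sum>M\<in>Pow F. real m * p M) = real m"
    using y_sum[of "{}"] y_eq[of "{}"] moment_empty[OF Y] by (simp add: sum_distrib_left[symmetric])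
  also have "(\<Sum>M\<in>Pow F. real (card M) * p M) = (\<Sum>M\<in>Pow F. \<Sum>e\<in>F. if {e} \<subseteq> M then p M else 0)"
  proof (intro sum.cong refl)
    fix M assume "M \<in> Pow F"
    then have "F \<inter> M = M" by auto
    then show "real (card M) * p M = (\<Sum>e\<in>F. if {e} \<subseteq> M then p M else 0)"
      by (simp add: sum.inter_restrict[symmetric])
  qed
  also have "\<dots> = (\<Sum>e\<in>F. \<Sum>M\<in>Pow F. if {e} \<subseteq> M then p M else 0)"
    by (rule sum.swap)
  also have "\<dots> = (\<Sum>e\<in>F. y {e})"
    by (intro sum.cong refl) (use y_sum in auto)
  also have "\<dots> = (\<Sum>e\<in>F. moment k Y {e} {})"
    by (intro sum.cong refl) (simp add: y_def is_matching_def)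
  finally show ?thesis by (simp add: F_def)
qed

lemma SA_plus_subset_int_hull_MT:
  fixes ends :: "'d::finite \<Rightarrow> 'v set"
  assumes card2: "\<And>e. card (ends e) = 2" and inj: "inj ends" and V: "\<And>e. ends e \<subseteq> V" "finite V"
    and cV: "card V \<le> 2 * n + 1" and l: "2 * (l * (l + 1)) \<le> n" and "0 < n - l"
  shows "SA_plus (n - l) (MT V ends) \<subseteq> int_hull (MT V ends)"
proof
  fix x :: "real^'d" assume "x \<in> SA_plus (n - l) (MT V ends)"
  then obtain Y where Y: "Y \<in> SA_plus_lift (n - l) (MT V ends)"
    and hat: "hat_vec (\<lambda>\<beta>. Y \<beta> zero_one) = (1, x)" by (auto simp: SA_plus_def)
  have "zero_one \<in> face_family (n - l)"
    using subcube_in_face_family[of "{}" "{}" "n - l"] by (simp add: subcube_empty)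
  moreover have "\<forall>\<alpha>\<in>face_family (n - l). hat_vec (\<lambda>\<beta>. Y \<beta> \<alpha>) \<in> homog_cone (MT V ends)
      \<and> (\<forall>\<beta>\<in>face_family (n - l). 0 \<le> Y \<beta> \<alpha>)"
    using Y unfolding SA_plus_lift_def mem_Collect_eq by (elim conjE)
  ultimately have "hat_vec (\<lambda>\<beta>. Y \<beta> zero_one) \<in> homog_cone (MT V ends)" by blast
  then have x: "x \<in> MT V ends" by (auto simp: hat homog_cone_def)
  have x_moment: "x $ e = moment (n - l) Y {e} {}" for e
  proof -
    have "x $ e = Y (restr {e} 1) zero_one" using hat by (auto simp: hat_vec_def)
    then show ?thesis
      using moment_subcubes[OF Y, of "{e}" "{}" "{}" "{}"] \<open>0 < n - l\<close>
      by (simp add: subcube_empty subcube_singleton)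
  qed
  show "x \<in> int_hull (MT V ends)"
  proof (rule in_int_hull_MT[OF card2 V x])
    fix U assume U: "U \<subseteq> V" "odd (card U)"
    then obtain m where m: "card U = 2 * m + 1" by (auto elim: oddE)
    \<comment> \<open>For small \<open>U\<close> this is \<open>m\<close>, so the square is exact at
      every size below \<open>m\<close> and the numerical condition is trivial.\<close>
    define K where "K = min (n - l) m"
    have "m \<le> n" using m cV card_mono[OF V(2) U(1)] by simp
    have "2 * ((m - K) * (m - K + 1)) \<le> m"
    proof (cases "m \<le> n - l")
      case False
      define r where "r = n - m"
      define d where "d = m - K"
      have ld: "l = d + r" "n = m + r"
        using False \<open>m \<le> n\<close> \<open>0 < n - l\<close> by (auto simp: d_def r_def K_def)
      \<comment> \<open>With \<open>2 * (l * (l + 1)) \<le> n = m + r\<close>, the summand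
        \<open>r\<close> cancels.\<close>
      have "2 * (d * (d + 1)) + r \<le> 2 * (l * (l + 1))"
        by (simp add: ld algebra_simps)
      then show ?thesis using l ld by (simp add: d_def[symmetric])
    qed (simp add: K_def)
    then have "(\<Sum>e | ends e \<subseteq> U. x $ e) \<le> real m"
      using sum_moment_le[OF card2 inj V(1) Y finite_subset[OF U(1) V(2)] m, of K]
      by (simp add: x_moment K_def)
    then show "2 * (\<Sum>e | ends e \<subseteq> U. x $ e) \<le> real (card U) - 1" by (simp add: m)
  qed
qed

section \<open>The bound on the rank\<close>

theorem theorem13:
  fixes n :: nat and V :: "'v set" and ends :: "'d::finite \<Rightarrow> 'v set"
  assumes "n \<ge> 1"
    and "finite V" and "card V = 2 * n + 1"
    and "bij_betw ends UNIV (complete_edges V)"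
  shows "op_rank SA_plus (MT V ends)
    \<le> enat (nat (int n - \<lfloor>(sqrt (2 * real n + 1) - 1) / 2\<rfloor>))"
proof -
  define l where "l = nat \<lfloor>(sqrt (2 * real n + 1) - 1) / 2\<rfloor>"
  have fl: "int l = \<lfloor>(sqrt (2 * real n + 1) - 1) / 2\<rfloor>" by (simp add: l_def)
  have "real l \<le> (sqrt (2 * real n + 1) - 1) / 2"
    using of_int_floor_le[of "(sqrt (2 * real n + 1) - 1) / 2"] fl by (metis of_int_of_nat_eq)
  \<comment> \<open>Squaring gives \<open>4 * l * l + 4 * l + 1 \<le> 2 * n + 1\<close>, which is
    the numerical condition on \<open>l\<close>.\<close>
  then have "2 * real l + 1 \<le> sqrt (2 * real n + 1)" by simp
  then have "(2 * real l + 1)\<^sup>2 \<le> (sqrt (2 * real n + 1))\<^sup>2" by (intro power_mono) auto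
  then have "real (2 * (l * (l + 1))) \<le> real n"
    by (simp add: power2_eq_square algebra_simps)
  then have l: "2 * (l * (l + 1)) \<le> n" by linarith
  \<comment> \<open>Hence \<open>n - l\<close> is positive and falls under the operator branch of
    \<open>op_rank\<close>.\<close>
  then have ln: "l < n"
    using \<open>n \<ge> 1\<close> by (cases "l = 0") (auto simp: algebra_simps)
  have ends: "ends e \<in> complete_edges V" for e using assms(4) by (auto simp: bij_betw_def)
  have "SA_plus (n - l) (MT V ends) \<subseteq> int_hull (MT V ends)"
    by (rule SA_plus_subset_int_hull_MT)
      (use ends assms ln l in \<open>auto simp: complete_edges_def bij_betw_def\<close>)
  then have "SA_plus (n - l) (MT V ends) = int_hull (MT V ends)"
    using int_hull_subset_SA_plus[OF convex_MT] by blast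
  then have "op_rank SA_plus (MT V ends) \<le> enat (n - l)"
    unfolding op_rank_def using ln by (intro INF_lower) auto
  moreover have "nat (int n - \<lfloor>(sqrt (2 * real n + 1) - 1) / 2\<rfloor>) = n - l"
    by (simp add: fl[symmetric] nat_diff_distrib)
  ultimately show ?thesis by simp
qed

end
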